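(* Let $p, q \ge 0$ be integers and let $M$ be (the total space of) a smooth $S^p$-bundle over $S^q$. Then the $(q-1)$-skeleton of any smooth triangulation of $M$ is embeddable into $\mathbb{R}^{p+q}$.
   Context: All manifolds are smooth and without boundary. An $S^p$-bundle over $S^q$ is a (smooth) locally trivial fiber bundle with base the sphere $S^q$ and fiber the sphere $S^p$. An embedding means a continuous map that is a homeomorphism onto its image (no smoothness required); a space is embeddable into $\mathbb{R}^m$ if such an embedding exists. A simplicial complex $K$ (identified with its geometric realization) is a smooth triangulation of a manifold $M$ if there is a homeomorphism $K \to M$ which restricts to a smooth embedding on each simplex of $K$. The $j$-skeleton of $K$ is the subcomplex of all simplices of dimension at most $j$ (empty if $j<0$). *)

theory Defs
  imports "HOL-Analysis.Analysis" "HOL-Homology.Homology"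
begin

text \<open>
  Points of \<open>\<real>\<^sup>n\<close> are functions of type \<^typ>\<open>nat \<Rightarrow> real\<close> that vanish from index \<open>n\<close> on, with the
  topology \<^term>\<open>Euclidean_space n\<close>. This permits \<open>n = 0\<close> and arithmetic on dimensions.
\<close>

section \<open>Smooth maps between open subsets of Euclidean spaces\<close>

definition partial :: "nat \<Rightarrow> ((nat \<Rightarrow> real) \<Rightarrow> real) \<Rightarrow> (nat \<Rightarrow> real) \<Rightarrow> real" where
  "partial i f x = deriv (\<lambda>t. f (x(i := t))) (x i)"

text \<open>
  \<open>C_on n U k f\<close>: on \<open>U\<close>, an open subset of \<open>\<real>\<^sup>n\<close>, all partial derivatives of \<open>f\<close> of order at most
  \<open>k\<close> exist and are continuous.
\<close>

primrec C_on ::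
  "nat \<Rightarrow> (nat \<Rightarrow> real) set \<Rightarrow> nat \<Rightarrow> ((nat \<Rightarrow> real) \<Rightarrow> real) \<Rightarrow> bool" where
  "C_on n U 0 f \<longleftrightarrow> continuous_map (subtopology (Euclidean_space n) U) euclideanreal f"
| "C_on n U (Suc k) f \<longleftrightarrow>
     continuous_map (subtopology (Euclidean_space n) U) euclideanreal f \<and>
     (\<forall>i<n. (\<forall>x\<in>U. (\<lambda>t. f (x(i := t))) differentiable at (x i)) \<and> C_on n U k (partial i f))"

definition smooth_on ::
  "nat \<Rightarrow> (nat \<Rightarrow> real) set \<Rightarrow> nat \<Rightarrow> ((nat \<Rightarrow> real) \<Rightarrow> nat \<Rightarrow> real) \<Rightarrow> bool" where
  "smooth_on m U n f \<longleftrightarrow>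
     openin (Euclidean_space m) U \<and> f \<in> U \<rightarrow> topspace (Euclidean_space n) \<and>
     (\<forall>j<n. \<forall>k. C_on m U k (\<lambda>x. f x j))"

section \<open>Smooth manifolds\<close>

definition second_countable_space :: "'a topology \<Rightarrow> bool" where
  "second_countable_space X \<longleftrightarrow>
     (\<exists>\<B>. countable \<B> \<and> (\<forall>V\<in>\<B>. openin X V) \<and>
        (\<forall>U x. openin X U \<and> x \<in> U \<longrightarrow> (\<exists>V\<in>\<B>. x \<in> V \<and> V \<subseteq> U)))"

text \<open>The atlas need not be maximal; the differentiable structure is the one it generates.\<close>

record 'a manifold =
  mtop :: "'a topology"
  mdim :: nat
  charts :: "('a set \<times> ('a \<Rightarrow> nat \<Rightarrow> real)) set"

definition smooth_manifold :: "'a manifold \<Rightarrow> bool" where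
  "smooth_manifold M \<longleftrightarrow>
     Hausdorff_space (mtop M) \<and> second_countable_space (mtop M) \<and>
     (\<Union>(U, \<phi>)\<in>charts M. U) = topspace (mtop M) \<and>
     (\<forall>(U, \<phi>)\<in>charts M.
        openin (mtop M) U \<and> openin (Euclidean_space (mdim M)) (\<phi> ` U) \<and>
        homeomorphic_map (subtopology (mtop M) U)
          (subtopology (Euclidean_space (mdim M)) (\<phi> ` U)) \<phi>) \<and>
     (\<forall>(U, \<phi>)\<in>charts M. \<forall>(V, \<psi>)\<in>charts M.
        smooth_on (mdim M) (\<phi> ` (U \<inter> V)) (mdim M) (\<psi> \<circ> inv_into U \<phi>))"

definition smooth_map :: "'a manifold \<Rightarrow> 'b manifold \<Rightarrow> ('a \<Rightarrow> 'b) \<Rightarrow> bool" where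
  "smooth_map M N f \<longleftrightarrow>
     continuous_map (mtop M) (mtop N) f \<and>
     (\<forall>(U, \<phi>)\<in>charts M. \<forall>(V, \<psi>)\<in>charts N.
        smooth_on (mdim M) (\<phi> ` (U \<inter> f -` V)) (mdim N) (\<psi> \<circ> f \<circ> inv_into U \<phi>))"

definition diffeomorphism :: "'a manifold \<Rightarrow> 'b manifold \<Rightarrow> ('a \<Rightarrow> 'b) \<Rightarrow> bool" where
  "diffeomorphism M N f \<longleftrightarrow>
     smooth_map M N f \<and> bij_betw f (topspace (mtop M)) (topspace (mtop N)) \<and>
     smooth_map N M (inv_into (topspace (mtop M)) f)"

definition open_submanifold :: "'a manifold \<Rightarrow> 'a set \<Rightarrow> 'a manifold" where
  "open_submanifold M W =
     \<lparr>mtop = subtopology (mtop M) W, mdim = mdim M,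
      charts = (\<lambda>(U, \<phi>). (U \<inter> W, \<phi>)) ` charts M\<rparr>"

definition concat_coords ::
  "nat \<Rightarrow> (nat \<Rightarrow> real) \<Rightarrow> (nat \<Rightarrow> real) \<Rightarrow> nat \<Rightarrow> real" where
  "concat_coords m x y = (\<lambda>i. if i < m then x i else y (i - m))"

definition prod_manifold :: "'a manifold \<Rightarrow> 'b manifold \<Rightarrow> ('a \<times> 'b) manifold" where
  "prod_manifold M N =
     \<lparr>mtop = prod_topology (mtop M) (mtop N), mdim = mdim M + mdim N,
      charts = {(U \<times> V, \<lambda>(x, y). concat_coords (mdim M) (\<phi> x) (\<psi> y)) |U \<phi> V \<psi>.
                  (U, \<phi>) \<in> charts M \<and> (V, \<psi>) \<in> charts N}\<rparr>"

text \<open>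
  The standard smooth structure of the unit sphere in \<open>\<real>\<^bsup>n+1\<^esup>\<close>: the charts are the projections
  of the open hemispheres \<open>\<plusminus>x\<^sub>i > 0\<close> that forget the coordinate \<open>x\<^sub>i\<close>.
\<close>

definition sphere_manifold :: "nat \<Rightarrow> (nat \<Rightarrow> real) manifold" where
  "sphere_manifold n =
     \<lparr>mtop = nsphere n, mdim = n,
      charts = {({x \<in> topspace (nsphere n). s * x i > 0},
                 \<lambda>x j. if j < i then x j else x (Suc j)) |i s. i \<le> n \<and> s \<in> {-1, 1}}\<rparr>"

definition smooth_fibre_bundle ::
  "'a manifold \<Rightarrow> 'b manifold \<Rightarrow> 'c manifold \<Rightarrow> ('a \<Rightarrow> 'b) \<Rightarrow> bool" where
  "smooth_fibre_bundle E B F \<pi> \<longleftrightarrow>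
     smooth_manifold E \<and> smooth_manifold B \<and> smooth_manifold F \<and> smooth_map E B \<pi> \<and>
     (\<forall>b\<in>topspace (mtop B). \<exists>U \<Phi>. openin (mtop B) U \<and> b \<in> U \<and>
        diffeomorphism (open_submanifold E {x \<in> topspace (mtop E). \<pi> x \<in> U})
          (prod_manifold (open_submanifold B U) F) \<Phi> \<and>
        (\<forall>x\<in>topspace (mtop E). \<pi> x \<in> U \<longrightarrow> fst (\<Phi> x) = \<pi> x))"

section \<open>Simplicial complexes and smooth triangulations\<close>

text \<open>
  Abstract simplicial complexes with non-empty simplices. No finiteness is assumed, in contrast to
  \<^const>\<open>simplicial_complex\<close>.
\<close>

definition abstract_complex :: "'v set set \<Rightarrow> bool" where
  "abstract_complex K \<longleftrightarrow>
     (\<forall>s\<in>K. finite s \<and> s \<noteq> {}) \<and> (\<forall>s\<in>K. \<forall>t. t \<noteq> {} \<and> t \<subseteq> s \<longrightarrow> t \<in> K)"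

definition skeleton :: "int \<Rightarrow> 'v set set \<Rightarrow> 'v set set" where
  "skeleton j K = {s \<in> K. int (card s) - 1 \<le> j}"

text \<open>The closed simplex spanned by a finite set of vertices, in barycentric coordinates.\<close>

definition closed_simplex :: "'v set \<Rightarrow> ('v \<Rightarrow> real) set" where
  "closed_simplex s = {x. (\<forall>v. 0 \<le> x v) \<and> (\<forall>v. v \<notin> s \<longrightarrow> x v = 0) \<and> sum x s = 1}"

text \<open>
  The geometric realization carries the weak topology with respect to its closed simplices, each
  of which has its usual Euclidean topology.
\<close>

definition realization_open :: "'v set set \<Rightarrow> ('v \<Rightarrow> real) set \<Rightarrow> bool" where
  "realization_open K W \<longleftrightarrow>
     W \<subseteq> (\<Union>s\<in>K. closed_simplex s) \<and>
     (\<forall>s\<in>K. openin (subtopology (powertop_real UNIV) (closed_simplex s)) (W \<inter> closed_simplex s))"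

definition realization :: "'v set set \<Rightarrow> ('v \<Rightarrow> real) topology" where
  "realization K = topology (realization_open K)"

lemma istopology_realization_open: "istopology (realization_open K)"
  unfolding istopology_def
proof (intro conjI allI impI)
  fix S T assume S: "realization_open K S" and T: "realization_open K T"
  have "openin (subtopology (powertop_real UNIV) (closed_simplex s)) (S \<inter> T \<inter> closed_simplex s)"
    if "s \<in> K" for s
  proof -
    have "S \<inter> T \<inter> closed_simplex s = (S \<inter> closed_simplex s) \<inter> (T \<inter> closed_simplex s)" by blast
    moreover have "openin (subtopology (powertop_real UNIV) (closed_simplex s)) \<dots>"
      using S T that unfolding realization_open_def by (intro openin_Int[of _ "S \<inter> _" "T \<inter> _"]) blast+
    ultimately show ?thesis by simp
  qed
  with S show "realization_open K (S \<inter> T)"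
    unfolding realization_open_def by blast
next
  fix \<W> assume \<W>: "\<forall>W\<in>\<W>. realization_open K W"
  have "openin (subtopology (powertop_real UNIV) (closed_simplex s)) (\<Union>\<W> \<inter> closed_simplex s)"
    if "s \<in> K" for s
  proof -
    have "\<Union>\<W> \<inter> closed_simplex s = (\<Union>W\<in>\<W>. W \<inter> closed_simplex s)" by blast
    moreover have "openin (subtopology (powertop_real UNIV) (closed_simplex s)) \<dots>"
      using \<W> that unfolding realization_open_def by (intro openin_Union) blast
    ultimately show ?thesis by simp
  qed
  with \<W> show "realization_open K (\<Union>\<W>)"
    unfolding realization_open_def by blast
qed

lemma openin_realization: "openin (realization K) = realization_open K"
  unfolding realization_def by (rule topology_inverse'[OF istopology_realization_open])

lemma topspace_realization: "topspace (realization K) = (\<Union>s\<in>K. closed_simplex s)"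
proof
  show "topspace (realization K) \<subseteq> (\<Union>s\<in>K. closed_simplex s)"
    by (auto simp: topspace_def openin_realization realization_open_def)
  have "(\<Union>s\<in>K. closed_simplex s) \<inter> closed_simplex s = closed_simplex s" if "s \<in> K" for s
    using that by blast
  moreover have "openin (subtopology (powertop_real UNIV) (closed_simplex s)) (closed_simplex s)"
    for s :: "'a set"
    using openin_topspace[of "subtopology (powertop_real UNIV) (closed_simplex s)"] by simp
  ultimately have "realization_open K (\<Union>s\<in>K. closed_simplex s)"
    unfolding realization_open_def by simp
  then show "(\<Union>s\<in>K. closed_simplex s) \<subseteq> topspace (realization K)"
    by (metis openin_realization openin_subset)
qed

text \<open>
  A smooth embedding of the standard \<open>k\<close>-simplex of \<open>\<real>\<^bsup>k+1\<^esup>\<close> into \<open>M\<close>: a topological embedding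
  that near each point extends, in a chart of \<open>M\<close>, to a smooth map \<open>g\<close> on an open subset of \<open>\<real>\<^bsup>k+1\<^esup>\<close>
  and whose differential there is injective on the tangent space \<open>{v. v\<^sub>0 + \<dots> + v\<^sub>k = 0}\<close> of the
  simplex. On that tangent space the differential of \<open>g\<close> does not depend on the choice of \<open>g\<close>.
\<close>

definition smooth_simplex_embedding ::
  "nat \<Rightarrow> 'a manifold \<Rightarrow> ((nat \<Rightarrow> real) \<Rightarrow> 'a) \<Rightarrow> bool" where
  "smooth_simplex_embedding k M \<sigma> \<longleftrightarrow>
     embedding_map (subtopology (Euclidean_space (Suc k)) (standard_simplex k)) (mtop M) \<sigma> \<and>
     (\<forall>x\<in>standard_simplex k. \<exists>(U, \<phi>)\<in>charts M. \<exists>W g.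
        x \<in> W \<and> smooth_on (Suc k) W (mdim M) g \<and>
        (\<forall>y\<in>W \<inter> standard_simplex k. \<sigma> y \<in> U \<and> g y = \<phi> (\<sigma> y)) \<and>
        (\<forall>v. (\<Sum>i\<le>k. v i) = 0 \<and>
             (\<forall>j<mdim M. (\<Sum>i\<le>k. v i * partial i (\<lambda>y. g y j) x) = 0) \<longrightarrow>
             (\<forall>i\<le>k. v i = 0)))"

text \<open>
  The affine parametrization of \<open>closed_simplex s\<close> by the standard \<open>k\<close>-simplex that is determined
  by an enumeration \<open>e\<close> of the vertices, i.e. a bijection from \<open>{..k}\<close> to \<open>s\<close>.
\<close>

definition simplex_param ::
  "nat \<Rightarrow> 'v set \<Rightarrow> (nat \<Rightarrow> 'v) \<Rightarrow> (nat \<Rightarrow> real) \<Rightarrow> 'v \<Rightarrow> real" where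
  "simplex_param k s e x = (\<lambda>v. if v \<in> s then x (inv_into {..k} e v) else 0)"

definition smooth_triangulation ::
  "'v set set \<Rightarrow> (('v \<Rightarrow> real) \<Rightarrow> 'a) \<Rightarrow> 'a manifold \<Rightarrow> bool" where
  "smooth_triangulation K h M \<longleftrightarrow>
     abstract_complex K \<and> homeomorphic_map (realization K) (mtop M) h \<and>
     (\<forall>s\<in>K. \<forall>k e. bij_betw e {..k} s \<longrightarrow>
        smooth_simplex_embedding k M (h \<circ> simplex_param k s e))"

definition embeddable :: "'a topology \<Rightarrow> 'b topology \<Rightarrow> bool" where
  "embeddable X Y \<longleftrightarrow> (\<exists>f. embedding_map X Y f)"

end

theory Submission
  imports Defs
begin

text \<open>
  By counting grid points, finitely many smooth images of simplices of dimension less than \<open>q\<close>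
  cannot cover a nonempty open subset of \<open>S\<^sup>q\<close>, so the projection of the \<open>(q-1)\<close>-skeleton misses a
  point \<open>b\<close> of \<open>S\<^sup>q\<close>. By compactness the skeleton projects into a cube of
  \<open>S\<^sup>q - {b} \<cong> \<real>\<^sup>q\<close>. The bundle is trivial over that cube: cut it into thin slabs and glue the
  trivializations along their common faces. Hence the skeleton injects continuously into
  \<open>S\<^sup>p \<times> \<real>\<^sup>q\<close>, which for \<open>q > 0\<close> sits in \<open>\<real>\<^bsup>p+q\<^esup>\<close> as \<open>(u, y) \<mapsto> (exp y\<^sub>0 u, y\<^sub>1, \<dots>, y\<^sub>q\<^sub>-\<^sub>1)\<close>.
\<close>

text \<open>Compactness is used three times. \<open>M\<close> is compact, so \<open>K\<close> is
  finite; this matters because box dimension, unlike Lebesgue measure zero, behaves well under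
  finite unions only. The projected skeleton is bounded in \<real>^q, so one cube suffices. Finally,
  an injective continuous map from a compact space to a Hausdorff space is an embedding, so no
  inverse on the image has to be studied. Lipschitz bounds are the right input for counting: they
  compose without a chain rule, and they turn a grid on a simplex of dimension k < q into about N^k
  sets of size O(1/N), whereas a cube in \<real>^q needs about N^q of them. Over a cube the obstacle
  is that two trivializations differ by a family of homeomorphisms of the fibre, defined over the
  common face only. A face is a retract of a slab, so the family extends by pulling back along the
  retraction; no property of the fibre enters the gluing. The dimension p + q is reached because
  \<real> \<times> S^p is \<real>^(p+1) without the origin. This needs one real factor, hence q > 0;
  for q = 0 the skeleton is empty.\<close>

section \<open>Local Lipschitz bounds for smooth maps\<close>

lemma openin_Euclidean_space_cube:
  assumes "openin (Euclidean_space n) U" "x \<in> U"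
  shows "\<exists>\<epsilon>>0. \<forall>y\<in>topspace (Euclidean_space n). (\<forall>i<n. \<bar>y i - x i\<bar> \<le> \<epsilon>) \<longrightarrow> y \<in> U"
proof -
  obtain T where T: "openin (powertop_real UNIV) T" "U = T \<inter> {x. \<forall>i\<ge>n. x i = 0}"
    using assms(1) by (auto simp: Euclidean_space_def openin_subtopology)
  have x: "x \<in> T" "\<And>i. i \<ge> n \<Longrightarrow> x i = 0"
    using assms(2) T by auto
  obtain X where X: "finite {i. X i \<noteq> UNIV}" "\<And>i. open (X i)" "x \<in> Pi\<^sub>E UNIV X" "Pi\<^sub>E UNIV X \<subseteq> T"
    using T(1) x(1) by (force simp: openin_product_topology_alt)
  have "\<exists>e>0. \<forall>t. \<bar>t - x i\<bar> \<le> e \<longrightarrow> t \<in> X i" for i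
  proof -
    have "x i \<in> X i"
      using X(3) by auto
    then obtain e where "e > 0" "cball (x i) e \<subseteq> X i"
      using X(2) open_contains_cball by blast
    then show ?thesis
      by (intro exI[of _ e]) (auto simp: subset_iff dist_real_def abs_minus_commute)
  qed
  then obtain e where e: "\<And>i. e i > 0" "\<And>i t. \<bar>t - x i\<bar> \<le> e i \<Longrightarrow> t \<in> X i"
    by metis
  \<comment> \<open>The inserted 1 keeps the minimum defined and positive for \<open>n = 0\<close>.
    Coordinates from \<open>n\<close> on vanish at both points and need no bound.\<close>
  define \<epsilon> where "\<epsilon> = Min (insert 1 (e ` {..<n}))"
  have \<epsilon>: "\<epsilon> > 0" "\<And>i. i < n \<Longrightarrow> \<epsilon> \<le> e i"
    using e(1) by (auto simp: \<epsilon>_def)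
  show ?thesis
  proof (intro exI[of _ \<epsilon>] conjI ballI impI \<epsilon>(1))
    fix y assume y: "y \<in> topspace (Euclidean_space n)" "\<forall>i<n. \<bar>y i - x i\<bar> \<le> \<epsilon>"
    have "y i \<in> X i" for i
    proof (cases "i < n")
      case True
      then show ?thesis
        using e(2) y(2) \<epsilon>(2) by fastforce
    next
      case False
      then show ?thesis
        using e(1,2) y(1) x(2) by (simp add: topspace_Euclidean_space less_imp_le)
    qed
    then have "y \<in> T"
      using X(4) by (auto simp: PiE_UNIV_domain)
    then show "y \<in> U"
      using y(1) T(2) by (auto simp: topspace_Euclidean_space)
  qed
qed

text \<open>Only partial derivatives are available, so the mean value theorem is applied along a
  path from \<open>z\<close> to \<open>y\<close> that changes one coordinate at a time. Such a path
  stays inside a cube, which is why neighbourhoods are cubes throughout.\<close>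

lemma C_on_1_locally_Lipschitz:
  assumes U: "openin (Euclidean_space m) U" "x \<in> U" and f: "C_on m U 1 f"
  shows "\<exists>\<epsilon>>0. \<exists>L\<ge>0. \<forall>y\<in>topspace (Euclidean_space m). \<forall>z\<in>topspace (Euclidean_space m).
    (\<forall>i<m. \<bar>y i - x i\<bar> \<le> \<epsilon>) \<longrightarrow> (\<forall>i<m. \<bar>z i - x i\<bar> \<le> \<epsilon>) \<longrightarrow>
    \<bar>f y - f z\<bar> \<le> L * (\<Sum>i<m. \<bar>y i - z i\<bar>)"
proof -
  have diff: "(\<lambda>t. f (y(i := t))) differentiable at (y i)" if "i < m" "y \<in> U" for i y
    using f that by simp
  \<comment> \<open>Adding 1 makes the bound strict at \<open>x\<close>, so that by continuity it
    persists on the open set \<open>?V\<close>; the inserted 0 covers \<open>m = 0\<close>.\<close>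
  define L where "L = 1 + Max (insert 0 ((\<lambda>i. \<bar>partial i f x\<bar>) ` {..<m}))"
  have L: "L \<ge> 1" "\<And>i. i < m \<Longrightarrow> \<bar>partial i f x\<bar> < L"
  proof -
    have "finite (insert 0 ((\<lambda>i. \<bar>partial i f x\<bar>) ` {..<m}))" by simp
    note * = Max_ge[OF this]
    show "L \<ge> 1" unfolding L_def using *[of 0] by simp
    show "\<bar>partial i f x\<bar> < L" if "i < m" for i
    proof -
      have "\<bar>partial i f x\<bar> \<in> insert 0 ((\<lambda>i. \<bar>partial i f x\<bar>) ` {..<m})" using that by blast
      from *[OF this] show ?thesis unfolding L_def by linarith
    qed
  qed
  let ?V = "{y \<in> U. \<forall>i<m. \<bar>partial i f y\<bar> < L}"
  have "openin (Euclidean_space m) ?V"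
  proof -
    have "openin (Euclidean_space m) {y \<in> U. \<bar>partial i f y\<bar> < L}" if "i < m" for i
    proof -
      have "continuous_map (subtopology (Euclidean_space m) U) euclideanreal (partial i f)"
        using f that by simp
      then have "openin (subtopology (Euclidean_space m) U)
          {y \<in> topspace (subtopology (Euclidean_space m) U). partial i f y \<in> {-L<..<L}}"
        by (intro openin_continuous_map_preimage) auto
      moreover have "topspace (subtopology (Euclidean_space m) U) = U"
        using openin_subset[OF U(1)] by auto
      moreover have "{y \<in> U. partial i f y \<in> {-L<..<L}} = {y \<in> U. \<bar>partial i f y\<bar> < L}"
        by auto
      ultimately show ?thesis
        using openin_trans_full[OF _ U(1)] by (simp only:)
    qed
    then have "openin (Euclidean_space m)
        (U \<inter> ((\<Inter>i\<in>{..<m}. {y \<in> U. \<bar>partial i f y\<bar> < L}) \<inter> topspace (Euclidean_space m)))"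
      by (intro openin_Int[OF U(1)] openin_INT) auto
    moreover have "?V = U \<inter> ((\<Inter>i\<in>{..<m}. {y \<in> U. \<bar>partial i f y\<bar> < L}) \<inter> topspace (Euclidean_space m))"
      using openin_subset[OF U(1)] by blast
    ultimately show ?thesis
      by (simp only:)
  qed
  moreover have "x \<in> ?V"
    using U(2) L(2) by auto
  ultimately obtain \<epsilon> where \<epsilon>: "\<epsilon> > 0"
    "\<And>y. \<lbrakk>y \<in> topspace (Euclidean_space m); \<And>i. i < m \<Longrightarrow> \<bar>y i - x i\<bar> \<le> \<epsilon>\<rbrakk> \<Longrightarrow> y \<in> ?V"
    using openin_Euclidean_space_cube[of m ?V x] by meson
  have "\<bar>f y - f z\<bar> \<le> L * (\<Sum>i<m. \<bar>y i - z i\<bar>)"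
    if y: "y \<in> topspace (Euclidean_space m)" "\<And>i. i < m \<Longrightarrow> \<bar>y i - x i\<bar> \<le> \<epsilon>"
      and z: "z \<in> topspace (Euclidean_space m)" "\<And>i. i < m \<Longrightarrow> \<bar>z i - x i\<bar> \<le> \<epsilon>" for y z
  proof -
    \<comment> \<open>The corners of the path: \<open>w 0\<close> is \<open>z\<close>,
      \<open>w m\<close> is \<open>y\<close>, and \<open>w (Suc k)\<close> differs from
      \<open>w k\<close> in coordinate \<open>k\<close> only.\<close>
    define w where "w k = (\<lambda>i. if i < k then y i else z i)" for k
    have step: "\<bar>f (w (Suc k)) - f (w k)\<bar> \<le> L * \<bar>y k - z k\<bar>" if k: "k < m" for k
    proof -
      have upd: "(w k)(k := t) \<in> ?V" if t: "t \<in> closed_segment (z k) (y k)" for t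
      proof (rule \<epsilon>(2))
        show "(w k)(k := t) \<in> topspace (Euclidean_space m)"
          using y(1) z(1) k by (auto simp: topspace_Euclidean_space w_def)
        have "\<bar>t - x k\<bar> \<le> \<epsilon>"
          using t y(2)[OF k] z(2)[OF k] by (auto simp: closed_segment_eq_real_ivl split: if_splits)
        then show "\<bar>((w k)(k := t)) i - x i\<bar> \<le> \<epsilon>" if "i < m" for i
          using y(2)[OF that] z(2)[OF that] by (auto simp: w_def)
      qed
      have "norm (f ((w k)(k := y k)) - f ((w k)(k := z k))) \<le> L * norm (y k - z k)"
      proof (rule field_differentiable_bound)
        show "convex (closed_segment (z k) (y k))" by simp
        fix t assume t: "t \<in> closed_segment (z k) (y k)"
        have V: "(w k)(k := t) \<in> ?V" by (rule upd[OF t])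
        have "(\<lambda>s. f (((w k)(k := t))(k := s))) differentiable at (((w k)(k := t)) k)"
          using V k by (intro diff) auto
        then have "((\<lambda>s. f ((w k)(k := s))) has_field_derivative partial k f ((w k)(k := t))) (at t)"
          unfolding partial_def by (simp add: DERIV_deriv_iff_real_differentiable)
        then show "((\<lambda>s. f ((w k)(k := s))) has_field_derivative partial k f ((w k)(k := t)))
            (at t within closed_segment (z k) (y k))"
          by (rule has_field_derivative_at_within)
        show "norm (partial k f ((w k)(k := t))) \<le> L"
          using V k by (auto intro: less_imp_le)
      qed auto
      moreover have "(w k)(k := y k) = w (Suc k)" "(w k)(k := z k) = w k"
        by (auto simp: w_def fun_eq_iff less_Suc_eq)
      ultimately show ?thesis by simp
    qed
    have "w m = y" "w 0 = z"
      using y(1) z(1) by (auto simp: w_def fun_eq_iff topspace_Euclidean_space)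
    then have "f y - f z = (\<Sum>k<m. f (w (Suc k)) - f (w k))"
      using sum_lessThan_telescope[of "\<lambda>k. f (w k)" m] by simp
    then have "\<bar>f y - f z\<bar> \<le> (\<Sum>k<m. \<bar>f (w (Suc k)) - f (w k)\<bar>)"
      by simp
    also have "\<dots> \<le> (\<Sum>k<m. L * \<bar>y k - z k\<bar>)"
      by (intro sum_mono step) auto
    finally show ?thesis
      by (simp add: sum_distrib_left)
  qed
  then show ?thesis
    using \<epsilon>(1) L(1) by (intro exI[of _ \<epsilon>] exI[of _ L] conjI) auto
qed

lemma smooth_on_locally_Lipschitz:
  assumes f: "smooth_on m U n f" and x: "x \<in> U"
  shows "\<exists>\<epsilon>>0. \<exists>L\<ge>0.
    (\<forall>y\<in>topspace (Euclidean_space m). (\<forall>i<m. \<bar>y i - x i\<bar> \<le> \<epsilon>) \<longrightarrow> y \<in> U) \<and>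
    (\<forall>y\<in>topspace (Euclidean_space m). \<forall>z\<in>topspace (Euclidean_space m).
       (\<forall>i<m. \<bar>y i - x i\<bar> \<le> \<epsilon>) \<longrightarrow> (\<forall>i<m. \<bar>z i - x i\<bar> \<le> \<epsilon>) \<longrightarrow>
       (\<forall>j<n. \<bar>f y j - f z j\<bar> \<le> L * (\<Sum>i<m. \<bar>y i - z i\<bar>)))"
proof -
  have U: "openin (Euclidean_space m) U" and C: "\<And>j. j < n \<Longrightarrow> C_on m U 1 (\<lambda>x. f x j)"
    using f unfolding smooth_on_def by blast+
  define R where "R j e L \<longleftrightarrow> (\<forall>y\<in>topspace (Euclidean_space m). \<forall>z\<in>topspace (Euclidean_space m).
    (\<forall>i<m. \<bar>y i - x i\<bar> \<le> e) \<longrightarrow> (\<forall>i<m. \<bar>z i - x i\<bar> \<le> e) \<longrightarrow>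
    \<bar>f y j - f z j\<bar> \<le> L * (\<Sum>i<m. \<bar>y i - z i\<bar>))" for j e L
  have "\<exists>e>0. \<exists>L\<ge>0. R j e L" if "j < n" for j
    unfolding R_def by (rule C_on_1_locally_Lipschitz[OF U x C[OF that]])
  then obtain e L where eL: "\<And>j. j < n \<Longrightarrow> e j > 0" "\<And>j. j < n \<Longrightarrow> L j \<ge> 0"
     "\<And>j. j < n \<Longrightarrow> R j (e j) (L j)"
    by metis
  obtain d where d: "d > 0"
    "\<And>y. \<lbrakk>y \<in> topspace (Euclidean_space m); \<And>i. i < m \<Longrightarrow> \<bar>y i - x i\<bar> \<le> d\<rbrakk> \<Longrightarrow> y \<in> U"
    using openin_Euclidean_space_cube[OF U x] by meson
  define \<epsilon> where "\<epsilon> = Min (insert d (e ` {..<n}))"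
  have \<epsilon>: "\<epsilon> > 0" "\<epsilon> \<le> d" "\<And>j. j < n \<Longrightarrow> \<epsilon> \<le> e j"
    using eL(1) d(1) by (auto simp: \<epsilon>_def)
  have "\<bar>f y j - f z j\<bar> \<le> sum L {..<n} * (\<Sum>i<m. \<bar>y i - z i\<bar>)"
    if *: "y \<in> topspace (Euclidean_space m)" "z \<in> topspace (Euclidean_space m)"
      "\<forall>i<m. \<bar>y i - x i\<bar> \<le> \<epsilon>" "\<forall>i<m. \<bar>z i - x i\<bar> \<le> \<epsilon>" "j < n" for y z j
  proof -
    have "\<forall>i<m. \<bar>y i - x i\<bar> \<le> e j" "\<forall>i<m. \<bar>z i - x i\<bar> \<le> e j"
      using *(3,4) \<epsilon>(3)[OF *(5)] by fastforce+
    then have "\<bar>f y j - f z j\<bar> \<le> L j * (\<Sum>i<m. \<bar>y i - z i\<bar>)"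
      using eL(3)[OF *(5)] *(1,2) unfolding R_def by blast
    also have "\<dots> \<le> sum L {..<n} * (\<Sum>i<m. \<bar>y i - z i\<bar>)"
      using *(5) eL(2) by (intro mult_right_mono member_le_sum sum_nonneg) auto
    finally show ?thesis .
  qed
  moreover have "y \<in> U" if "y \<in> topspace (Euclidean_space m)" "\<forall>i<m. \<bar>y i - x i\<bar> \<le> \<epsilon>" for y
    using that \<epsilon>(2) by (intro d(2)) fastforce+
  ultimately show ?thesis
    using \<epsilon>(1) eL(2) by (intro exI[of _ \<epsilon>] exI[of _ "sum L {..<n}"] conjI) (auto intro: sum_nonneg)
qed

section \<open>Covering numbers\<close>

text \<open>The diameter is measured in the sup metric of the first \<open>n\<close> coordinates.
  Sets without centres are used since the image of a small set under a Lipschitz map is again of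
  this kind.\<close>

definition covered :: "nat \<Rightarrow> nat \<Rightarrow> real \<Rightarrow> (nat \<Rightarrow> real) set \<Rightarrow> bool" where
  "covered n c \<delta> Z \<longleftrightarrow> (\<exists>\<D>. finite \<D> \<and> card \<D> \<le> c \<and> Z \<subseteq> \<Union>\<D> \<and>
     (\<forall>D\<in>\<D>. \<forall>x\<in>D. \<forall>y\<in>D. \<forall>i<n. \<bar>x i - y i\<bar> \<le> \<delta>))"

text \<open>\<open>thin n\<close> says that the box dimension is at most \<open>n - 1\<close>; it is used for \<open>n > 0\<close> only.\<close>

definition thin :: "nat \<Rightarrow> (nat \<Rightarrow> real) set \<Rightarrow> bool" where
  "thin n Z \<longleftrightarrow> (\<exists>C. \<forall>N\<ge>1. covered n (C * N ^ (n - 1)) (real C / real N) Z)"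

lemma covered_Un:
  assumes "covered n c \<delta> Y" "covered n c' \<delta>' Z" "\<delta> \<le> \<epsilon>" "\<delta>' \<le> \<epsilon>"
  shows "covered n (c + c') \<epsilon> (Y \<union> Z)"
proof -
  obtain \<D> where D: "finite \<D>" "card \<D> \<le> c" "Y \<subseteq> \<Union>\<D>"
    "\<forall>D\<in>\<D>. \<forall>x\<in>D. \<forall>y\<in>D. \<forall>i<n. \<bar>x i - y i\<bar> \<le> \<delta>"
    using assms(1) unfolding covered_def by auto
  obtain \<D>' where D': "finite \<D>'" "card \<D>' \<le> c'" "Z \<subseteq> \<Union>\<D>'"
    "\<forall>D\<in>\<D>'. \<forall>x\<in>D. \<forall>y\<in>D. \<forall>i<n. \<bar>x i - y i\<bar> \<le> \<delta>'"
    using assms(2) unfolding covered_def by auto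
  show ?thesis
    unfolding covered_def
  proof (intro exI[of _ "\<D> \<union> \<D>'"] conjI ballI allI impI)
    show "card (\<D> \<union> \<D>') \<le> c + c'"
      using card_Un_le[of \<D> \<D>'] D(2) D'(2) by linarith
    show "Y \<union> Z \<subseteq> \<Union>(\<D> \<union> \<D>')"
      using D(3) D'(3) by blast
    fix D x y i assume *: "D \<in> \<D> \<union> \<D>'" "x \<in> D" "y \<in> D" "i < n"
    then have "\<bar>x i - y i\<bar> \<le> \<delta> \<or> \<bar>x i - y i\<bar> \<le> \<delta>'"
      using D(4) D'(4) by blast
    then show "\<bar>x i - y i\<bar> \<le> \<epsilon>"
      using assms(3,4) by linarith
  qed (use D(1) D'(1) in auto)
qed

lemma thin_subset: "\<lbrakk>thin n Z; Y \<subseteq> Z\<rbrakk> \<Longrightarrow> thin n Y"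
  unfolding thin_def covered_def by (meson order_trans)

lemma thin_empty: "thin n {}"
  unfolding thin_def covered_def by (intro exI[of _ 0] allI impI exI[of _ "{}"]) auto

text \<open>One constant bounds both the number of sets and their scaled diameter, so the sum of the
  two constants serves for the union.\<close>

lemma thin_Un:
  assumes "thin n Y" "thin n Z"
  shows "thin n (Y \<union> Z)"
proof -
  obtain C C' where C: "\<And>N. N \<ge> 1 \<Longrightarrow> covered n (C * N ^ (n - 1)) (real C / real N) Y"
      "\<And>N. N \<ge> 1 \<Longrightarrow> covered n (C' * N ^ (n - 1)) (real C' / real N) Z"
    using assms unfolding thin_def by auto
  have "covered n ((C + C') * N ^ (n - 1)) (real (C + C') / real N) (Y \<union> Z)" if "N \<ge> 1" for N
    unfolding distrib_right
    by (rule covered_Un[OF C[OF that]]) (auto intro: divide_right_mono)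
  then show ?thesis
    unfolding thin_def by blast
qed

lemma thin_UN:
  assumes "finite I" "\<And>i. i \<in> I \<Longrightarrow> thin n (Z i)"
  shows "thin n (\<Union>i\<in>I. Z i)"
  using assms by (induction I rule: finite_induct) (auto simp: thin_empty intro: thin_Un)

text \<open>Pigeonhole on the N^n grid points of spacing a/N: a set of diameter C/N contains at most
  (2K+1)^n of them, where K is C/a rounded up. A thin cover would thus account for at most C
  (2K+1)^n N^(n-1) points, which is too few once N exceeds C (2K+1)^n.\<close>

lemma cube_not_thin:
  assumes a: "a > 0" and n: "n > 0"
    and Z: "{x \<in> topspace (Euclidean_space n). \<forall>i<n. \<bar>x i\<bar> \<le> a} \<subseteq> Z"
  shows "\<not> thin n Z"
proof
  assume "thin n Z"
  then obtain C where C: "\<And>N. N \<ge> 1 \<Longrightarrow> covered n (C * N ^ (n - 1)) (real C / real N) Z"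
    unfolding thin_def by auto
  define K where "K = nat \<lceil>real C / a\<rceil>"
  define N where "N = Suc (C * (2 * K + 1) ^ n)"
  have N: "N \<ge> 1" by (simp add: N_def)
  obtain \<D> where D: "finite \<D>" "card \<D> \<le> C * N ^ (n - 1)" "Z \<subseteq> \<Union>\<D>"
      "\<forall>D\<in>\<D>. \<forall>x\<in>D. \<forall>y\<in>D. \<forall>i<n. \<bar>x i - y i\<bar> \<le> real C / real N"
      using C[OF N] unfolding covered_def by auto
  define G where "G = PiE {..<n} (\<lambda>_. {..<N})"
  define P where "P m = (\<lambda>i. if i < n then a * real (m i) / real N else 0)" for m :: "nat \<Rightarrow> nat"
  define S where "S D = {m \<in> G. P m \<in> D}" for D
  have G: "finite G" "card G = N ^ n"
    by (simp_all add: G_def finite_PiE card_PiE)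
  have "P m \<in> Z" if "m \<in> G" for m
  proof -
    have "real (m i) / real N \<le> 1" if "i < n" for i
    proof -
      have "m i < N"
        using \<open>m \<in> G\<close> that by (auto simp: G_def)
      then show ?thesis by simp
    qed
    then have "\<bar>P m i\<bar> \<le> a" if "i < n" for i
      using a that mult_left_mono[of "real (m i) / real N" 1 a] by (simp add: P_def)
    then have "P m \<in> {x \<in> topspace (Euclidean_space n). \<forall>i<n. \<bar>x i\<bar> \<le> a}"
      by (auto simp: P_def topspace_Euclidean_space)
    then show ?thesis using Z by blast
  qed
  then have "G \<subseteq> (\<Union>D\<in>\<D>. S D)"
    using D(3) by (auto simp: S_def)
  moreover have S: "finite (S D)" "card (S D) \<le> (2 * K + 1) ^ n" if "D \<in> \<D>" for D
  proof -
    show "finite (S D)"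
      using G(1) by (simp add: S_def)
    show "card (S D) \<le> (2 * K + 1) ^ n"
    proof (cases "S D = {}")
      case False
      then obtain m where m: "m \<in> S D" by blast
      \<comment> \<open>Grid points in the same \<open>D\<close> differ by at most \<open>K\<close>
        steps in each coordinate. The truncated difference \<open>m i - K\<close> can only shorten
        the interval, so it has at most 2K+1 elements.\<close>
      have "S D \<subseteq> PiE {..<n} (\<lambda>i. {m i - K..m i + K})"
      proof
        fix m' assume m': "m' \<in> S D"
        have "m' i \<in> {m i - K..m i + K}" if i: "i < n" for i
        proof -
          have "\<bar>P m i - P m' i\<bar> \<le> real C / real N"
            using D(4) \<open>D \<in> \<D>\<close> i m m' by (auto simp: S_def)
          moreover have "P m i - P m' i = a * (real (m i) - real (m' i)) / real N"
            using i by (simp add: P_def diff_divide_distrib right_diff_distrib)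
          ultimately have "a * \<bar>real (m i) - real (m' i)\<bar> \<le> real C"
            using a N by (simp add: abs_mult divide_le_cancel)
          then have "\<bar>real (m i) - real (m' i)\<bar> \<le> real C / a"
            using a by (simp add: field_simps)
          also have "\<dots> \<le> real K"
            unfolding K_def by linarith
          finally show ?thesis by auto
        qed
        then show "m' \<in> PiE {..<n} (\<lambda>i. {m i - K..m i + K})"
          using m' by (auto simp: S_def G_def PiE_iff)
      qed
      then have "card (S D) \<le> card (PiE {..<n} (\<lambda>i. {m i - K..m i + K}))"
        by (intro card_mono finite_PiE) auto
      also have "\<dots> = (\<Prod>i<n. card {m i - K..m i + K})"
        by (simp add: card_PiE)
      also have "\<dots> \<le> (\<Prod>i<n. 2 * K + 1)"
        by (intro prod_mono) auto
      finally show ?thesis by simp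
    qed simp
  qed
  ultimately have "card G \<le> card (\<Union>D\<in>\<D>. S D)"
    using D(1) by (intro card_mono) auto
  also have "\<dots> \<le> (\<Sum>D\<in>\<D>. card (S D))"
    using D(1) by (rule card_UN_le)
  also have "\<dots> \<le> card \<D> * (2 * K + 1) ^ n"
    using sum_bounded_above[of \<D> "\<lambda>D. card (S D)"] S(2) by simp
  also have "\<dots> \<le> C * N ^ (n - 1) * (2 * K + 1) ^ n"
    using D(2) by (intro mult_right_mono) auto
  also have "\<dots> = (C * (2 * K + 1) ^ n) * N ^ (n - 1)"
    by simp
  also have "\<dots> < N * N ^ (n - 1)"
    using N by (intro mult_strict_right_mono) (auto simp: N_def)
  \<comment> \<open>Here \<open>n > 0\<close> is essential, because \<open>n - 1\<close> is
    truncated.\<close>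
  also have "\<dots> = N ^ n"
    using n by (metis power_eq_if less_numeral_extra(3))
  finally show False
    using G(2) by simp
qed

text \<open>The simplex lies in \<real>^(k+1), but its coordinates sum to 1, so a grid on the first
  k of them controls the last one as well. This gives (N+1)^k cells instead of (N+1)^(k+1), and k is
  at most n-1.\<close>

lemma thin_Lipschitz_image:
  assumes A: "A \<subseteq> standard_simplex k" and kn: "k < n"
    and f: "\<And>y z j. \<lbrakk>y \<in> A; z \<in> A; j < n\<rbrakk> \<Longrightarrow> \<bar>f y j - f z j\<bar> \<le> L * (\<Sum>i<Suc k. \<bar>y i - z i\<bar>)"
    and L: "L \<ge> 0"
  shows "thin n (f ` A)"
proof -
  \<comment> \<open>The first entry bounds the number of cells, as (N+1)^k is at most 2^k N^k. The
    second bounds the diameters: in a cell the first k coordinates differ by at most 1/N each, and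
    the last by at most their total, whence 2k/N.\<close>
  define C where "C = max (2 ^ k) (nat \<lceil>L * (2 * real k)\<rceil>)"
  have C: "2 ^ k \<le> C" "L * (2 * real k) \<le> real C"
    unfolding C_def by linarith+
  show ?thesis
    unfolding thin_def
  proof (intro exI[of _ C] allI impI)
    fix N :: nat assume N: "N \<ge> 1"
    define cell where "cell m = {x \<in> A. \<forall>i<k. nat \<lfloor>real N * x i\<rfloor> = m i}" for m
    \<comment> \<open>The value \<open>N\<close> occurs, when a coordinate equals 1; hence N+1
      values per coordinate.\<close>
    define I where "I = PiE {..<k} (\<lambda>_. {..N})"
    have I: "finite I" "card I = (N + 1) ^ k"
      by (simp_all add: I_def finite_PiE card_PiE)
    show "covered n (C * N ^ (n - 1)) (real C / real N) (f ` A)"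
      unfolding covered_def
    proof (intro exI[of _ "(\<lambda>m. f ` cell m) ` I"] conjI ballI allI impI)
      show "finite ((\<lambda>m. f ` cell m) ` I)"
        using I(1) by simp
      have "card ((\<lambda>m. f ` cell m) ` I) \<le> (N + 1) ^ k"
        using card_image_le[OF I(1)] I(2) by metis
      also have "\<dots> \<le> (2 * N) ^ k"
        using N by (intro power_mono) auto
      also have "\<dots> \<le> C * N ^ (n - 1)"
        unfolding power_mult_distrib using C(1) N kn by (intro mult_mono power_increasing) auto
      finally show "card ((\<lambda>m. f ` cell m) ` I) \<le> C * N ^ (n - 1)" .
      show "f ` A \<subseteq> \<Union>((\<lambda>m. f ` cell m) ` I)"
      proof
        fix w assume "w \<in> f ` A"
        then obtain x where x: "x \<in> A" "w = f x" by blast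
        define m where "m = restrict (\<lambda>i. nat \<lfloor>real N * x i\<rfloor>) {..<k}"
        have "nat \<lfloor>real N * x i\<rfloor> \<le> N" for i
        proof -
          have "0 \<le> x i" "x i \<le> 1"
            using x(1) A by (auto simp: standard_simplex_def)
          then have "real N * x i \<le> real N * 1" by (intro mult_left_mono) auto
          then show ?thesis by linarith
        qed
        then have "m \<in> I" by (auto simp: m_def I_def)
        moreover have "x \<in> cell m"
          using x(1) by (auto simp: cell_def m_def)
        ultimately show "w \<in> \<Union>((\<lambda>m. f ` cell m) ` I)"
          using x(2) by blast
      qed
      fix D u v j assume D: "D \<in> (\<lambda>m. f ` cell m) ` I" "u \<in> D" "v \<in> D" and j: "j < n"
      then obtain m x y where m: "x \<in> cell m" "y \<in> cell m" "u = f x" "v = f y"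
        by blast
      have xy: "x \<in> A" "y \<in> A" using m by (auto simp: cell_def)
      have close: "\<bar>x i - y i\<bar> \<le> 1 / real N" if i: "i < k" for i
      proof -
        have "nat \<lfloor>real N * x i\<rfloor> = nat \<lfloor>real N * y i\<rfloor>"
          using m i by (simp add: cell_def)
        moreover have "0 \<le> real N * x i" "0 \<le> real N * y i"
          using xy A by (auto simp: standard_simplex_def)
        ultimately have "\<bar>real N * x i - real N * y i\<bar> \<le> 1" by linarith
        then have "real N * \<bar>x i - y i\<bar> \<le> 1"
          by (simp add: abs_mult flip: right_diff_distrib)
        then show ?thesis using N by (simp add: field_simps)
      qed
      have "(\<Sum>i\<le>k. x i) = 1" "(\<Sum>i\<le>k. y i) = 1"
        using xy A by (auto simp: standard_simplex_def)
      then have "x k - y k = (\<Sum>i<k. y i - x i)"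
        by (simp add: sum_subtractf flip: lessThan_Suc_atMost)
      then have "\<bar>x k - y k\<bar> \<le> (\<Sum>i<k. \<bar>y i - x i\<bar>)" by simp
      then have "(\<Sum>i<Suc k. \<bar>x i - y i\<bar>) \<le> 2 * (\<Sum>i<k. \<bar>x i - y i\<bar>)"
        by (simp add: abs_minus_commute)
      also have "(\<Sum>i<k. \<bar>x i - y i\<bar>) \<le> real k * (1 / real N)"
        using sum_bounded_above[of "{..<k}" "\<lambda>i. \<bar>x i - y i\<bar>" "1 / real N"] close by simp
      finally have "(\<Sum>i<Suc k. \<bar>x i - y i\<bar>) \<le> 2 * real k / real N" by simp
      then have "L * (\<Sum>i<Suc k. \<bar>x i - y i\<bar>) \<le> L * (2 * real k / real N)"
        using L by (rule mult_left_mono)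
      also have "\<dots> = L * (2 * real k) / real N" by simp
      also have "\<dots> \<le> real C / real N"
        using C(2) by (rule divide_right_mono) simp
      finally show "\<bar>u j - v j\<bar> \<le> real C / real N"
        using f[OF xy j] m(3,4) by simp
    qed
  qed
qed

section \<open>Punctured spheres\<close>

text \<open>Moves to the type class topology on functions, where continuity can be proved by
  \<open>continuous_on\<close> rules.\<close>

lemma Euclidean_space_top_of_set: "Euclidean_space n = top_of_set (topspace (Euclidean_space n))"
  by (simp add: Euclidean_space_def euclidean_product_topology)

lemma nsphere_top_of_set: "nsphere n = top_of_set (topspace (nsphere n))"
  by (simp add: nsphere euclidean_product_topology)

lemma topspace_nsphere:
  "topspace (nsphere n) = {x. (\<forall>i>n. x i = 0) \<and> (\<Sum>i\<le>n. (x i)\<^sup>2) = 1}"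
  by (auto simp: nsphere topspace_product_topology)

text \<open>Stereographic projection \<open>\<sigma>\<close> from the pole. With \<open>d y\<close>
  = |y|^2 + 1, its inverse \<open>c\<close> is the usual y \<mapsto> ((|y|^2 - 1)/(|y|^2 + 1),
  2y/(|y|^2 + 1)).\<close>

lemma nsphere_minus_pole_homeomorphic_Euclidean_space:
  "subtopology (nsphere n) (- {\<lambda>i. if i = 0 then 1 else 0}) homeomorphic_space Euclidean_space n"
proof -
  define e :: "nat \<Rightarrow> real" where "e = (\<lambda>i. if i = 0 then 1 else 0)"
  define S where "S = topspace (nsphere n) - {e}"
  define \<sigma> :: "(nat \<Rightarrow> real) \<Rightarrow> nat \<Rightarrow> real" where "\<sigma> x = (\<lambda>i. x (Suc i) / (1 - x 0))" for x
  define d :: "(nat \<Rightarrow> real) \<Rightarrow> real" where "d y = (\<Sum>i<n. (y i)\<^sup>2) + 1" for y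
  define c :: "(nat \<Rightarrow> real) \<Rightarrow> nat \<Rightarrow> real" where "c y = case_nat ((d y - 2) / d y) (\<lambda>i. 2 * y i / d y)" for y
  have split: "(\<Sum>i\<le>n. f i) = f 0 + (\<Sum>i<n. f (Suc i))" for f :: "nat \<Rightarrow> real"
    by (simp add: sum.lessThan_Suc_shift del: sum.lessThan_Suc flip: lessThan_Suc_atMost)
  have x0: "x 0 \<noteq> 1" if "x \<in> S" for x
  proof
    assume "x 0 = 1"
    then have "(\<Sum>i<n. (x (Suc i))\<^sup>2) = 0"
      using that split[of "\<lambda>i. (x i)\<^sup>2"] by (simp add: S_def topspace_nsphere)
    then have "\<forall>i<n. x (Suc i) = 0" by (simp add: sum_nonneg_eq_0_iff)
    then have "x i = e i" for i
      using that \<open>x 0 = 1\<close> by (cases i) (simp_all add: e_def S_def topspace_nsphere, metis not_less_eq)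
    then have "x = e" by blast
    then show False using that by (simp add: S_def)
  qed
  have dpos: "d y > 0" for y
    unfolding d_def by (intro add_nonneg_pos sum_nonneg) auto
  have \<sigma>S: "\<sigma> x \<in> topspace (Euclidean_space n)" if "x \<in> S" for x
    using that by (auto simp: \<sigma>_def topspace_Euclidean_space S_def topspace_nsphere)
  have cS: "c y \<in> S" if y: "y \<in> topspace (Euclidean_space n)" for y
  proof -
    have "(\<Sum>i\<le>n. (c y i)\<^sup>2) = ((d y - 2) / d y)\<^sup>2 + (\<Sum>i<n. (2 * y i / d y)\<^sup>2)"
      unfolding split by (simp add: c_def)
    also have "(\<Sum>i<n. (2 * y i / d y)\<^sup>2) = 4 * (d y - 1) / (d y)\<^sup>2"
      by (simp add: power_divide power_mult_distrib d_def sum_divide_distrib sum_distrib_left)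
    also have "((d y - 2) / d y)\<^sup>2 + 4 * (d y - 1) / (d y)\<^sup>2 = 1"
      using dpos[of y] by (simp add: power_divide field_simps) (simp add: power2_eq_square algebra_simps)
    finally have "(\<Sum>i\<le>n. (c y i)\<^sup>2) = 1" .
    moreover have "c y i = 0" if "i > n" for i
      using that y by (cases i) (auto simp: c_def topspace_Euclidean_space)
    moreover have "c y 0 \<noteq> e 0"
      using dpos[of y] by (simp add: c_def e_def field_simps)
    ultimately show ?thesis by (auto simp: S_def topspace_nsphere)
  qed
  have c\<sigma>: "c (\<sigma> x) = x" if x: "x \<in> S" for x
  proof -
    have "(\<Sum>i<n. (x (Suc i))\<^sup>2) = 1 - (x 0)\<^sup>2"
      using x split[of "\<lambda>i. (x i)\<^sup>2"] by (simp add: S_def topspace_nsphere)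
    then have "d (\<sigma> x) = (1 - (x 0)\<^sup>2) / (1 - x 0)\<^sup>2 + 1"
      by (simp add: d_def \<sigma>_def power_divide flip: sum_divide_distrib)
    also have "\<dots> = 2 / (1 - x 0)"
      using x0[OF x] by (simp add: power2_eq_square divide_simps) (simp add: algebra_simps)
    finally have d: "d (\<sigma> x) = 2 / (1 - x 0)" .
    have "c (\<sigma> x) i = x i" for i
      using x0[OF x] unfolding c_def d by (cases i) (auto simp: \<sigma>_def divide_simps)
    then show ?thesis by blast
  qed
  have \<sigma>c: "\<sigma> (c y) = y" for y
    using dpos[of y] by (auto simp: \<sigma>_def c_def divide_simps)
  have "continuous_on S \<sigma>"
    unfolding \<sigma>_def using x0
    by (intro continuous_on_coordinatewise_then_product continuous_intros
        continuous_on_subset[OF continuous_on_product_coordinates]) auto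
  moreover have "continuous_on UNIV c"
  proof (rule continuous_on_coordinatewise_then_product)
    have "continuous_on UNIV d"
      unfolding d_def by (intro continuous_intros continuous_on_product_coordinates)
    moreover have "d y \<noteq> 0" for y using dpos[of y] by simp
    ultimately show "continuous_on UNIV (\<lambda>y. c y i)" for i
      unfolding c_def by (cases i) (auto intro!: continuous_intros continuous_on_product_coordinates)
  qed
  ultimately have "homeomorphic_maps (top_of_set S) (top_of_set (topspace (Euclidean_space n))) \<sigma> c"
    using \<sigma>S cS c\<sigma> \<sigma>c
    by (auto simp: homeomorphic_maps_def intro: continuous_on_subset)
  moreover have "subtopology (nsphere n) (- {e}) = top_of_set S"
    by (subst nsphere_top_of_set) (simp add: subtopology_subtopology S_def Diff_eq)
  ultimately show ?thesis
    using Euclidean_space_top_of_set[of n] unfolding e_def homeomorphic_space_def by metis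
qed

text \<open>The reflection in the bisector of the two points. If they coincide, division by zero
  makes the formula yield the identity.\<close>

lemma nsphere_homeomorphic_maps_pole:
  assumes b: "b \<in> topspace (nsphere n)"
  obtains H where "homeomorphic_maps (nsphere n) (nsphere n) H H" "H b = (\<lambda>i. if i = 0 then 1 else 0)"
proof -
  define e :: "nat \<Rightarrow> real" where "e = (\<lambda>i. if i = 0 then 1 else 0)"
  define w where "w = (\<lambda>i. b i - e i)"
  define ip where "ip x = (\<Sum>i\<le>n. x i * w i)" for x
  define H :: "(nat \<Rightarrow> real) \<Rightarrow> nat \<Rightarrow> real" where "H x = (\<lambda>i. x i - 2 * ip x / ip w * w i)" for x
  have ipH: "ip (H x) = - ip x" for x
  proof (cases "ip w = 0")
    case True
    then have "\<forall>i\<le>n. w i = 0"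
      by (simp add: ip_def sum_nonneg_eq_0_iff)
    then have "ip x = 0" for x by (simp add: ip_def)
    then show ?thesis by simp
  next
    case False
    have "ip (H x) = ip x - 2 * ip x / ip w * ip w"
      by (simp add: ip_def H_def left_diff_distrib sum_subtractf sum_distrib_left mult.assoc)
    then show ?thesis using False by simp
  qed
  \<comment> \<open>Since \<open>H\<close> negates the inner product with \<open>w\<close>, the
    second application adds back the multiple of \<open>w\<close> that the first removed.\<close>
  have HH: "H (H x) = x" for x
    using ipH[of x] unfolding H_def[of "H x"] by (auto simp: H_def)
  have w: "w i = 0" if "i > n" for i
    using b that by (simp add: w_def e_def topspace_nsphere)
  have HS: "H x \<in> topspace (nsphere n)" if x: "x \<in> topspace (nsphere n)" for x
  proof -
    define t where "t = 2 * ip x / ip w"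
    have "(H x i)\<^sup>2 = (x i)\<^sup>2 - 2 * t * (x i * w i) + t\<^sup>2 * (w i * w i)" for i
      unfolding H_def t_def[symmetric] by (simp add: power2_eq_square algebra_simps)
    then have "(\<Sum>i\<le>n. (H x i)\<^sup>2) = (\<Sum>i\<le>n. (x i)\<^sup>2) - 2 * t * ip x + t\<^sup>2 * ip w"
      by (simp add: ip_def sum.distrib sum_subtractf sum_distrib_left)
    also have "\<dots> = (\<Sum>i\<le>n. (x i)\<^sup>2)"
      by (simp add: t_def power2_eq_square)
    finally show ?thesis
      using x w by (auto simp: topspace_nsphere H_def)
  qed
  have "continuous_on (topspace (nsphere n)) H"
    unfolding H_def ip_def divide_inverse
    by (intro continuous_on_coordinatewise_then_product continuous_intros
        continuous_on_subset[OF continuous_on_product_coordinates]) auto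
  then have "homeomorphic_maps (top_of_set (topspace (nsphere n))) (top_of_set (topspace (nsphere n))) H H"
    using HS HH by (auto simp: homeomorphic_maps_def)
  then have "homeomorphic_maps (nsphere n) (nsphere n) H H"
    using nsphere_top_of_set by metis
  moreover have "H b = e"
  proof (cases "ip w = 0")
    case True
    then have "\<forall>i\<le>n. w i = 0"
      by (simp add: ip_def sum_nonneg_eq_0_iff)
    then have "w = (\<lambda>_. 0)" using w by (metis not_le)
    then show ?thesis by (auto simp: H_def w_def fun_eq_iff)
  next
    case False
    have "(\<Sum>i\<le>n. b i * e i) = b 0" "(\<Sum>i\<le>n. e i * w i) = w 0"
      by (simp_all add: e_def if_distrib[of "\<lambda>t. t * _"] if_distrib[of "\<lambda>t. _ * t"] cong: if_cong)
    moreover have "(\<Sum>i\<le>n. b i * b i) = 1"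
      using b by (simp add: topspace_nsphere power2_eq_square)
    moreover have "ip b = (\<Sum>i\<le>n. b i * b i) - (\<Sum>i\<le>n. b i * e i)"
      by (simp add: ip_def w_def right_diff_distrib sum_subtractf)
    moreover have "ip w = (\<Sum>i\<le>n. b i * w i - e i * w i)"
      by (simp add: ip_def w_def left_diff_distrib)
    ultimately have "ip b = 1 - b 0" "ip w = ip b - w 0"
      by (simp_all add: sum_subtractf ip_def[of b])
    \<comment> \<open>For unit vectors, |b - e|^2 = 2 - 2<b,e> = 2<b, b - e>. So the reflection
      subtracts \<open>w\<close> exactly once from \<open>b\<close>, which leaves
      \<open>e\<close>.\<close>
    then have "2 * ip b = ip w" by (simp add: w_def e_def)
    then have "2 * ip b / ip w = 1" using False by simp
    then show ?thesis by (auto simp: H_def w_def)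
  qed
  ultimately show thesis using that by (simp add: e_def)
qed

lemma nsphere_minus_point_homeomorphic_Euclidean_space:
  assumes "b \<in> topspace (nsphere n)"
  shows "subtopology (nsphere n) (- {b}) homeomorphic_space Euclidean_space n"
proof -
  define e :: "nat \<Rightarrow> real" where "e = (\<lambda>i. if i = 0 then 1 else 0)"
  obtain H where H: "homeomorphic_maps (nsphere n) (nsphere n) H H" "H b = e"
    using nsphere_homeomorphic_maps_pole[OF assms] unfolding e_def by blast
  have HH: "H (H x) = x" if "x \<in> topspace (nsphere n)" for x
    using H(1) that by (simp add: homeomorphic_maps_def)
  have "H ` (topspace (nsphere n) \<inter> - {b}) \<subseteq> - {e}" "H ` (topspace (nsphere n) \<inter> - {e}) \<subseteq> - {b}"
  proof -
    have "x = b" if "x \<in> topspace (nsphere n)" "H x = e" for x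
      using HH[OF that(1)] HH[OF assms] H(2) that(2) by simp
    moreover have "x = e" if "x \<in> topspace (nsphere n)" "H x = b" for x
      using HH[OF that(1)] H(2) that(2) by simp
    ultimately show "H ` (topspace (nsphere n) \<inter> - {b}) \<subseteq> - {e}"
      "H ` (topspace (nsphere n) \<inter> - {e}) \<subseteq> - {b}"
      by blast+
  qed
  then have "homeomorphic_maps (subtopology (nsphere n) (- {b})) (subtopology (nsphere n) (- {e})) H H"
    by (rule homeomorphic_maps_subtopologies_alt[OF H(1)])
  then have "subtopology (nsphere n) (- {b}) homeomorphic_space subtopology (nsphere n) (- {e})"
    unfolding homeomorphic_space_def by blast
  also have "\<dots> homeomorphic_space Euclidean_space n"
    unfolding e_def by (rule nsphere_minus_pole_homeomorphic_Euclidean_space)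
  finally show ?thesis .
qed

section \<open>Smooth images of low-dimensional simplices\<close>

text \<open>Near \<open>x\<close> the map \<open>\<psi> \<circ> f \<circ> \<sigma>\<close> is
  \<open>P \<circ> g\<close> on the simplex, where \<open>g\<close> is the smooth local extension of
  \<open>\<phi> \<circ> \<sigma>\<close> and \<open>P\<close> is \<open>f\<close> read in charts.
  Both factors are locally Lipschitz, and it remains to match their domains.\<close>

lemma smooth_simplex_embedding_locally_Lipschitz:
  assumes M: "smooth_manifold M" and f: "smooth_map M N f"
    and \<sigma>: "smooth_simplex_embedding k M \<sigma>" and x: "x \<in> standard_simplex k"
    and V: "(V, \<psi>) \<in> charts N" "f (\<sigma> x) \<in> V"
  shows "\<exists>\<epsilon>>0. \<exists>L\<ge>0. \<forall>y\<in>standard_simplex k. \<forall>z\<in>standard_simplex k.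
    (\<forall>i<Suc k. \<bar>y i - x i\<bar> \<le> \<epsilon>) \<longrightarrow> (\<forall>i<Suc k. \<bar>z i - x i\<bar> \<le> \<epsilon>) \<longrightarrow>
    (\<forall>j<mdim N. \<bar>\<psi> (f (\<sigma> y)) j - \<psi> (f (\<sigma> z)) j\<bar> \<le> L * (\<Sum>i<Suc k. \<bar>y i - z i\<bar>))"
proof -
  obtain U \<phi> W g where U: "(U, \<phi>) \<in> charts M" and W: "x \<in> W" "smooth_on (Suc k) W (mdim M) g"
    and g: "\<forall>y\<in>W \<inter> standard_simplex k. \<sigma> y \<in> U \<and> g y = \<phi> (\<sigma> y)"
    using \<sigma> x unfolding smooth_simplex_embedding_def by blast
  define O' where "O' = \<phi> ` (U \<inter> f -` V)"
  define P where "P = \<psi> \<circ> f \<circ> inv_into U \<phi>"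
  have P: "smooth_on (mdim M) O' (mdim N) P"
    using f U V(1) unfolding smooth_map_def O'_def P_def by blast
  have "openin (mtop M) U" "homeomorphic_map (subtopology (mtop M) U)
          (subtopology (Euclidean_space (mdim M)) (\<phi> ` U)) \<phi>"
    using M U unfolding smooth_manifold_def by blast+
  \<comment> \<open>Needed for \<open>inv_into U \<phi>\<close> inside \<open>P\<close> to undo
    \<open>\<phi>\<close>.\<close>
  then have inj: "inj_on \<phi> U"
    by (metis homeomorphic_imp_injective_map openin_subset topspace_subtopology_subset)
  have gO: "g x \<in> O'"
    using g W(1) x V(2) by (auto simp: O'_def)
  have Pg: "P (g y) = \<psi> (f (\<sigma> y))" if "y \<in> W" "y \<in> standard_simplex k" for y
    using g that inj by (auto simp: P_def)
  have simplex: "standard_simplex k \<subseteq> topspace (Euclidean_space (Suc k))"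
    by (auto simp: standard_simplex_def topspace_Euclidean_space)
  have gtop: "g y \<in> topspace (Euclidean_space (mdim M))" if "y \<in> W" for y
    using W(2) that by (auto simp: smooth_on_def)
  obtain \<epsilon> L where \<epsilon>: "\<epsilon> > 0" "L \<ge> 0"
    "\<forall>y\<in>topspace (Euclidean_space (Suc k)). (\<forall>i<Suc k. \<bar>y i - x i\<bar> \<le> \<epsilon>) \<longrightarrow> y \<in> W"
    and Lip: "\<forall>y\<in>topspace (Euclidean_space (Suc k)). \<forall>z\<in>topspace (Euclidean_space (Suc k)).
       (\<forall>i<Suc k. \<bar>y i - x i\<bar> \<le> \<epsilon>) \<longrightarrow> (\<forall>i<Suc k. \<bar>z i - x i\<bar> \<le> \<epsilon>) \<longrightarrow>
       (\<forall>j<mdim M. \<bar>g y j - g z j\<bar> \<le> L * (\<Sum>i<Suc k. \<bar>y i - z i\<bar>))"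
    using smooth_on_locally_Lipschitz[OF W(2,1)] by (elim exE conjE)
  obtain \<delta> L' where \<delta>: "\<delta> > 0" "L' \<ge> 0"
    and Lip': "\<forall>y\<in>topspace (Euclidean_space (mdim M)). \<forall>z\<in>topspace (Euclidean_space (mdim M)).
       (\<forall>i<mdim M. \<bar>y i - g x i\<bar> \<le> \<delta>) \<longrightarrow> (\<forall>i<mdim M. \<bar>z i - g x i\<bar> \<le> \<delta>) \<longrightarrow>
       (\<forall>j<mdim N. \<bar>P y j - P z j\<bar> \<le> L' * (\<Sum>i<mdim M. \<bar>y i - z i\<bar>))"
    using smooth_on_locally_Lipschitz[OF P gO] by (elim exE conjE)
  \<comment> \<open>Within distance \<open>\<eta>\<close> of \<open>x\<close> the value of
    \<open>g\<close> moves by at most L (k+1) \<eta>, hence stays in the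
    \<open>\<delta>\<close>-cube where \<open>P\<close> is Lipschitz. The summand 1 avoids a zero
    denominator.\<close>
  define \<eta> where "\<eta> = min \<epsilon> (\<delta> / (L * real (Suc k) + 1))"
  have pos: "L * real (Suc k) + 1 > 0"
    using \<epsilon>(2) by (simp add: add_nonneg_pos)
  then have \<eta>: "\<eta> > 0" "\<eta> \<le> \<epsilon>" "\<eta> * (L * real (Suc k) + 1) \<le> \<delta>"
    using \<epsilon>(1) \<delta>(1) by (simp_all add: \<eta>_def pos_le_divide_eq[symmetric])
  have near: "y \<in> W \<and> (\<forall>i<Suc k. \<bar>y i - x i\<bar> \<le> \<epsilon>) \<and> (\<forall>j<mdim M. \<bar>g y j - g x j\<bar> \<le> \<delta>)"
    if y: "y \<in> standard_simplex k" "\<forall>i<Suc k. \<bar>y i - x i\<bar> \<le> \<eta>" for y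
  proof (intro conjI allI impI)
    have y\<epsilon>: "\<forall>i<Suc k. \<bar>y i - x i\<bar> \<le> \<epsilon>"
      using y(2) \<eta>(2) by force
    then show "\<bar>y i - x i\<bar> \<le> \<epsilon>" if "i < Suc k" for i
      using that by blast
    show "y \<in> W"
      using y(1) y\<epsilon> \<epsilon>(3) simplex by blast
    fix j assume "j < mdim M"
    moreover have "\<forall>i<Suc k. \<bar>x i - x i\<bar> \<le> \<epsilon>" using \<epsilon>(1) by simp
    ultimately have "\<bar>g y j - g x j\<bar> \<le> L * (\<Sum>i<Suc k. \<bar>y i - x i\<bar>)"
      using Lip y(1) y\<epsilon> x simplex by blast
    also have "(\<Sum>i<Suc k. \<bar>y i - x i\<bar>) \<le> real (Suc k) * \<eta>"
      using sum_bounded_above[of "{..<Suc k}" "\<lambda>i. \<bar>y i - x i\<bar>" \<eta>] y(2) by simp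
    also have "L * (real (Suc k) * \<eta>) \<le> \<eta> * (L * real (Suc k) + 1)"
      using \<eta>(1) by (simp add: algebra_simps)
    finally show "\<bar>g y j - g x j\<bar> \<le> \<delta>"
      using \<eta>(3) \<epsilon>(2) by (simp add: mult_left_mono)
  qed
  have "\<bar>\<psi> (f (\<sigma> y)) j - \<psi> (f (\<sigma> z)) j\<bar> \<le> (L' * real (mdim M) * L) * (\<Sum>i<Suc k. \<bar>y i - z i\<bar>)"
    if y: "y \<in> standard_simplex k" "\<forall>i<Suc k. \<bar>y i - x i\<bar> \<le> \<eta>"
      and z: "z \<in> standard_simplex k" "\<forall>i<Suc k. \<bar>z i - x i\<bar> \<le> \<eta>" and j: "j < mdim N" for y z j
  proof -
    note ny = near[OF y] and nz = near[OF z]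
    have "\<bar>P (g y) j - P (g z) j\<bar> \<le> L' * (\<Sum>i<mdim M. \<bar>g y i - g z i\<bar>)"
      using Lip' ny nz gtop j by blast
    also have "(\<Sum>i<mdim M. \<bar>g y i - g z i\<bar>) \<le> real (mdim M) * (L * (\<Sum>i<Suc k. \<bar>y i - z i\<bar>))"
    proof -
      have "\<bar>g y i - g z i\<bar> \<le> L * (\<Sum>i<Suc k. \<bar>y i - z i\<bar>)" if "i < mdim M" for i
        using Lip ny nz y(1) z(1) simplex that by blast
      then show ?thesis
        using sum_bounded_above[of "{..<mdim M}" "\<lambda>i. \<bar>g y i - g z i\<bar>"] by simp
    qed
    finally show ?thesis
      using Pg ny nz y(1) z(1) \<delta>(2) by (simp add: mult.assoc mult_left_mono)
  qed
  moreover have "L' * real (mdim M) * L \<ge> 0"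
    using \<delta>(2) \<epsilon>(2) by simp
  ultimately show ?thesis
    using \<eta>(1) by (intro exI[of _ \<eta>] exI[of _ "L' * real (mdim M) * L"] conjI) auto
qed

text \<open>The chart is defined only on \<open>V\<close>, whose preimage in the simplex need not be
  compact. Cutting down to a closed \<open>C\<close> inside \<open>V\<close> makes the preimage
  compact, so finitely many local Lipschitz bounds suffice.\<close>

lemma thin_smooth_image:
  assumes M: "smooth_manifold M" and f: "smooth_map M N f"
    and \<sigma>: "smooth_simplex_embedding k M \<sigma>" and V: "(V, \<psi>) \<in> charts N"
    and C: "closedin (mtop N) C" "C \<subseteq> V" and k: "k < mdim N"
  shows "thin (mdim N) (\<psi> ` (C \<inter> f ` \<sigma> ` standard_simplex k))"
proof -
  define A where "A = {x \<in> standard_simplex k. f (\<sigma> x) \<in> C}"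
  have "embedding_map (subtopology (Euclidean_space (Suc k)) (standard_simplex k)) (mtop M) \<sigma>"
    using \<sigma> by (simp add: smooth_simplex_embedding_def)
  then have "continuous_map (subtopology (Euclidean_space (Suc k)) (standard_simplex k)) (mtop M) \<sigma>"
    by (metis continuous_map_in_subtopology embedding_map_def homeomorphic_imp_continuous_map)
  moreover have "subtopology (Euclidean_space (Suc k)) (standard_simplex k) = top_of_set (standard_simplex k)"
  proof -
    have "{x. \<forall>i\<ge>Suc k. x i = 0} \<inter> standard_simplex k = standard_simplex k"
      by (auto simp: standard_simplex_def)
    then show ?thesis
      unfolding Euclidean_space_def subtopology_subtopology by (simp add: euclidean_product_topology)
  qed
  moreover have "continuous_map (mtop M) (mtop N) f"
    using f by (simp add: smooth_map_def)
  ultimately have "continuous_map (top_of_set (standard_simplex k)) (mtop N) (f \<circ> \<sigma>)"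
    by (metis continuous_map_compose)
  then have "closedin (top_of_set (standard_simplex k)) {x \<in> topspace (top_of_set (standard_simplex k)). (f \<circ> \<sigma>) x \<in> C}"
    using C(1) by (rule closedin_continuous_map_preimage)
  then have "closedin (top_of_set (standard_simplex k)) A"
    by (simp add: A_def)
  moreover have "compact (standard_simplex k)"
    using compactin_standard_simplex[of k] by (simp add: euclidean_product_topology)
  ultimately have A: "compact A"
    by (rule closedin_compact[rotated])
  define R where "R x \<epsilon> L \<longleftrightarrow> (\<forall>y\<in>standard_simplex k. \<forall>z\<in>standard_simplex k.
    (\<forall>i<Suc k. \<bar>y i - x i\<bar> \<le> \<epsilon>) \<longrightarrow> (\<forall>i<Suc k. \<bar>z i - x i\<bar> \<le> \<epsilon>) \<longrightarrow>
    (\<forall>j<mdim N. \<bar>\<psi> (f (\<sigma> y)) j - \<psi> (f (\<sigma> z)) j\<bar> \<le> L * (\<Sum>i<Suc k. \<bar>y i - z i\<bar>)))" for x \<epsilon> L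
  have "\<exists>\<epsilon>>0. \<exists>L\<ge>0. R x \<epsilon> L" if "x \<in> A" for x
    unfolding R_def
    using that C(2) by (intro smooth_simplex_embedding_locally_Lipschitz[OF M f \<sigma> _ V]) (auto simp: A_def)
  then obtain \<epsilon> L where \<epsilon>: "\<And>x. x \<in> A \<Longrightarrow> \<epsilon> x > 0" "\<And>x. x \<in> A \<Longrightarrow> L x \<ge> 0" "\<And>x. x \<in> A \<Longrightarrow> R x (\<epsilon> x) (L x)"
    by metis
  \<comment> \<open>These sets restrict only finitely many coordinates and are therefore open in the
    product topology.\<close>
  define B where "B x = (\<Inter>i<Suc k. {y. \<bar>y i - x i\<bar> < \<epsilon> x})" for x
  have "open (B x)" for x
    unfolding B_def by (intro open_INT ballI open_Collect_less continuous_intros) auto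
  moreover have "A \<subseteq> (\<Union>x\<in>A. B x)"
    using \<epsilon>(1) by (auto simp: B_def)
  ultimately obtain F where F: "F \<subseteq> A" "finite F" "A \<subseteq> (\<Union>x\<in>F. B x)"
    using compactE_image[OF A, of A B] by metis
  have "thin (mdim N) ((\<lambda>y. \<psi> (f (\<sigma> y))) ` (A \<inter> B x))" if x: "x \<in> F" for x
  proof (rule thin_Lipschitz_image)
    show "A \<inter> B x \<subseteq> standard_simplex k" by (auto simp: A_def)
    have xA: "x \<in> A" using x F by blast
    show "0 \<le> L x" by (rule \<epsilon>(2)[OF xA])
    fix y z j assume "y \<in> A \<inter> B x" "z \<in> A \<inter> B x" and j: "j < mdim N"
    then have "y \<in> standard_simplex k" "z \<in> standard_simplex k"
       "\<forall>i<Suc k. \<bar>y i - x i\<bar> \<le> \<epsilon> x" "\<forall>i<Suc k. \<bar>z i - x i\<bar> \<le> \<epsilon> x"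
      by (auto simp: A_def B_def intro: less_imp_le)
    then show "\<bar>\<psi> (f (\<sigma> y)) j - \<psi> (f (\<sigma> z)) j\<bar> \<le> L x * (\<Sum>i<Suc k. \<bar>y i - z i\<bar>)"
      using \<epsilon>(3)[OF xA] j unfolding R_def by blast
  qed (rule k)
  then have "thin (mdim N) (\<Union>x\<in>F. (\<lambda>y. \<psi> (f (\<sigma> y))) ` (A \<inter> B x))"
    by (rule thin_UN[OF F(2)])
  moreover have "\<psi> ` (C \<inter> f ` \<sigma> ` standard_simplex k) \<subseteq> (\<Union>x\<in>F. (\<lambda>y. \<psi> (f (\<sigma> y))) ` (A \<inter> B x))"
  proof
    fix w assume "w \<in> \<psi> ` (C \<inter> f ` \<sigma> ` standard_simplex k)"
    then obtain y where "y \<in> A" "w = \<psi> (f (\<sigma> y))" by (auto simp: A_def)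
    then show "w \<in> (\<Union>x\<in>F. (\<lambda>y. \<psi> (f (\<sigma> y))) ` (A \<inter> B x))" using F(3) by blast
  qed
  ultimately show ?thesis
    by (rule thin_subset)
qed

text \<open>One chart is enough: the closed cap \<open>C\<close> already projects onto a set
  containing a cube, while a covering of the sphere would make this projection a finite union of
  thin sets.\<close>

lemma smooth_simplices_miss_sphere_point:
  assumes M: "smooth_manifold M" and f: "smooth_map M (sphere_manifold q) f" and q: "q > 0"
    and I: "finite I" "\<And>i. i \<in> I \<Longrightarrow> k i < q"
      "\<And>i. i \<in> I \<Longrightarrow> smooth_simplex_embedding (k i) M (\<sigma> i)"
  shows "\<exists>b\<in>topspace (nsphere q). b \<notin> (\<Union>i\<in>I. f ` \<sigma> i ` standard_simplex (k i))"
proof (rule ccontr)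
  assume "\<not> ?thesis"
  then have cover: "topspace (nsphere q) \<subseteq> (\<Union>i\<in>I. f ` \<sigma> i ` standard_simplex (k i))" by blast
  let ?N = "sphere_manifold q"
  \<comment> \<open>The hemisphere \<open>i = 0\<close>, \<open>s = 1\<close>, written literally as
    in \<open>sphere_manifold\<close>; since \<open>j < 0\<close> never holds, \<open>\<psi>\<close>
    simply drops coordinate 0.\<close>
  define V where "V = {x \<in> topspace (nsphere q). 1 * x 0 > 0}"
  define \<psi> where "\<psi> = (\<lambda>x j. if j < 0 then x j else x (Suc j) :: real)"
  define C where "C = {x \<in> topspace (nsphere q). x 0 \<in> {1/2..}}"
  have V: "(V, \<psi>) \<in> charts ?N"
    unfolding V_def \<psi>_def sphere_manifold_def manifold.simps mem_Collect_eq
    by (rule exI[of _ 0], rule exI[of _ 1]) simp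
  have "closedin (nsphere q) C"
    unfolding C_def
    by (rule closedin_continuous_map_preimage[OF continuous_map_nsphere_projection]) auto
  then have C: "closedin (mtop ?N) C" "C \<subseteq> V"
    by (auto simp: sphere_manifold_def C_def V_def)
  have dim: "mdim ?N = q" by (simp add: sphere_manifold_def)
  have "thin q (\<psi> ` (C \<inter> f ` \<sigma> i ` standard_simplex (k i)))" if "i \<in> I" for i
    using thin_smooth_image[OF M f I(3)[OF that] V C] I(2)[OF that] dim by simp
  then have thin: "thin q (\<Union>i\<in>I. \<psi> ` (C \<inter> f ` \<sigma> i ` standard_simplex (k i)))"
    by (rule thin_UN[OF I(1)])
  \<comment> \<open>The side is chosen so that the squares sum to at most 1/2: each is at most
    1/(2q), as the coordinates are at most 1 in absolute value. The lifted coordinate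
    \<open>t\<close> then satisfies t^2 \<ge> 1/2, which puts the lift in the cap.\<close>
  have "{x \<in> topspace (Euclidean_space q). \<forall>i<q. \<bar>x i\<bar> \<le> 1 / (2 * real q)}
      \<subseteq> (\<Union>i\<in>I. \<psi> ` (C \<inter> f ` \<sigma> i ` standard_simplex (k i)))"
  proof clarify
    fix x assume x: "x \<in> topspace (Euclidean_space q)" "\<forall>i<q. \<bar>x i\<bar> \<le> 1 / (2 * real q)"
    have "(x i)\<^sup>2 \<le> 1 / (2 * real q)" if "i < q" for i
    proof -
      have "\<bar>x i\<bar> * \<bar>x i\<bar> \<le> 1 / (2 * real q) * 1"
        using x(2) that q by (intro mult_mono) (auto intro: order_trans[of _ "1 / (2 * real q)"])
      then show ?thesis by (simp add: power2_eq_square)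
    qed
    then have "(\<Sum>i<q. (x i)\<^sup>2) \<le> real q * (1 / (2 * real q))"
      using sum_bounded_above[of "{..<q}" "\<lambda>i. (x i)\<^sup>2" "1 / (2 * real q)"] by simp
    then have s: "(\<Sum>i<q. (x i)\<^sup>2) \<le> 1/2"
      using q by simp
    define t where "t = sqrt (1 - (\<Sum>i<q. (x i)\<^sup>2))"
    have t: "t\<^sup>2 = 1 - (\<Sum>i<q. (x i)\<^sup>2)" "t \<ge> 1/2"
    proof -
      show "t\<^sup>2 = 1 - (\<Sum>i<q. (x i)\<^sup>2)"
        using s by (simp add: t_def)
      have "(1/2)\<^sup>2 \<le> 1 - (\<Sum>i<q. (x i)\<^sup>2)"
        unfolding power2_eq_square[of "1/2"] using s by simp
      then show "t \<ge> 1/2"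
        unfolding t_def by (rule real_le_rsqrt)
    qed
    define y where "y = case_nat t x"
    have "(\<Sum>i\<le>q. (y i)\<^sup>2) = t\<^sup>2 + (\<Sum>i<q. (x i)\<^sup>2)"
      by (simp add: y_def sum.lessThan_Suc_shift del: sum.lessThan_Suc flip: lessThan_Suc_atMost)
    then have "y \<in> topspace (nsphere q)"
      using x(1) t(1) by (auto simp: topspace_nsphere topspace_Euclidean_space y_def split: nat.split)
    then have "y \<in> C" using t(2) by (simp add: C_def y_def)
    moreover obtain i where i: "i \<in> I" "y \<in> f ` \<sigma> i ` standard_simplex (k i)"
      using cover \<open>y \<in> topspace (nsphere q)\<close> by blast
    ultimately have "\<psi> y \<in> \<psi> ` (C \<inter> f ` \<sigma> i ` standard_simplex (k i))"
      by (intro imageI IntI)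
    moreover have "\<psi> y = x" by (simp add: \<psi>_def y_def)
    ultimately show "x \<in> (\<Union>i\<in>I. \<psi> ` (C \<inter> f ` \<sigma> i ` standard_simplex (k i)))"
      using i(1) by (intro UN_I[of i]) simp_all
  qed
  then have "\<not> thin q (\<Union>i\<in>I. \<psi> ` (C \<inter> f ` \<sigma> i ` standard_simplex (k i)))"
    using q by (intro cube_not_thin[of "1 / (2 * real q)"]) auto
  then show False using thin by simp
qed

section \<open>Local triviality over cubes\<close>

text \<open>\<open>\<phi>\<close> is the fibre coordinate of a trivialization and \<open>\<psi>\<close> its inverse.\<close>

definition trivial_over ::
  "'e topology \<Rightarrow> 'b topology \<Rightarrow> 'f topology \<Rightarrow> ('e \<Rightarrow> 'b) \<Rightarrow> 'b set \<Rightarrow> bool" where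
  "trivial_over E B F \<rho> A \<longleftrightarrow> (\<exists>\<phi> \<psi>.
     continuous_map (subtopology E {e \<in> topspace E. \<rho> e \<in> A}) F \<phi> \<and>
     continuous_map (prod_topology (subtopology B A) F) E \<psi> \<and>
     (\<forall>e\<in>topspace E. \<rho> e \<in> A \<longrightarrow> \<psi> (\<rho> e, \<phi> e) = e) \<and>
     (\<forall>b\<in>topspace B \<inter> A. \<forall>f\<in>topspace F. \<rho> (\<psi> (b, f)) = b \<and> \<phi> (\<psi> (b, f)) = f))"

lemma trivial_over_subset:
  assumes "trivial_over E B F \<rho> A" "A' \<subseteq> A"
  shows "trivial_over E B F \<rho> A'"
proof -
  obtain \<phi> \<psi> where *: "continuous_map (subtopology E {e \<in> topspace E. \<rho> e \<in> A}) F \<phi>"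
     "continuous_map (prod_topology (subtopology B A) F) E \<psi>"
     "\<forall>e\<in>topspace E. \<rho> e \<in> A \<longrightarrow> \<psi> (\<rho> e, \<phi> e) = e"
     "\<forall>b\<in>topspace B \<inter> A. \<forall>f\<in>topspace F. \<rho> (\<psi> (b, f)) = b \<and> \<phi> (\<psi> (b, f)) = f"
    using assms(1) unfolding trivial_over_def by auto
  have "continuous_map (subtopology E {e \<in> topspace E. \<rho> e \<in> A'}) F \<phi>"
    using assms(2) by (intro continuous_map_from_subtopology_mono[OF *(1)]) auto
  moreover have "continuous_map (prod_topology (subtopology B A') F) E \<psi>"
  proof -
    have "prod_topology (subtopology B A') F = subtopology (prod_topology (subtopology B A) F) (A' \<times> UNIV)"
      using assms(2) by (simp add: prod_topology_subtopology subtopology_subtopology Int_absorb1 Times_Int_Times)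
    then show ?thesis
      using *(2) by (simp add: continuous_map_from_subtopology)
  qed
  ultimately show ?thesis
    unfolding trivial_over_def using *(3,4) assms(2) by (intro exI[of _ \<phi>] exI[of _ \<psi>]) blast
qed

text \<open>
  The transition function over \<open>A \<inter> A'\<close>, extended to \<open>A'\<close> along the retraction \<open>r\<close>, corrects the
  trivialization over \<open>A'\<close> to one that agrees with the given one over \<open>A \<inter> A'\<close>. The maps \<open>g\<close> and
  \<open>g'\<close> below are this extension and its fibrewise inverse.
\<close>

lemma trivial_over_glue:
  assumes \<rho>: "continuous_map E B \<rho>"
    and trivial: "trivial_over E B F \<rho> A" "trivial_over E B F \<rho> A'"
    and closed: "closedin B A" "closedin B A'"
    and r: "continuous_map (subtopology B A') B r" "\<And>b. b \<in> A' \<Longrightarrow> r b \<in> A \<inter> A'"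
      "\<And>b. b \<in> A \<inter> A' \<Longrightarrow> r b = b"
  shows "trivial_over E B F \<rho> (A \<union> A')"
proof -
  obtain \<phi> \<psi> where A: "continuous_map (subtopology E {e \<in> topspace E. \<rho> e \<in> A}) F \<phi>"
     "continuous_map (prod_topology (subtopology B A) F) E \<psi>"
     "\<And>e. \<lbrakk>e \<in> topspace E; \<rho> e \<in> A\<rbrakk> \<Longrightarrow> \<psi> (\<rho> e, \<phi> e) = e"
     "\<And>b f. \<lbrakk>b \<in> A; f \<in> topspace F\<rbrakk> \<Longrightarrow> \<rho> (\<psi> (b, f)) = b"
     "\<And>b f. \<lbrakk>b \<in> A; f \<in> topspace F\<rbrakk> \<Longrightarrow> \<phi> (\<psi> (b, f)) = f"
    using trivial(1) closedin_subset[OF closed(1)] unfolding trivial_over_def by blast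
  obtain \<phi>' \<psi>' where A': "continuous_map (subtopology E {e \<in> topspace E. \<rho> e \<in> A'}) F \<phi>'"
     "continuous_map (prod_topology (subtopology B A') F) E \<psi>'"
     "\<And>e. \<lbrakk>e \<in> topspace E; \<rho> e \<in> A'\<rbrakk> \<Longrightarrow> \<psi>' (\<rho> e, \<phi>' e) = e"
     "\<And>b f. \<lbrakk>b \<in> A'; f \<in> topspace F\<rbrakk> \<Longrightarrow> \<rho> (\<psi>' (b, f)) = b"
     "\<And>b f. \<lbrakk>b \<in> A'; f \<in> topspace F\<rbrakk> \<Longrightarrow> \<phi>' (\<psi>' (b, f)) = f"
    using trivial(2) closedin_subset[OF closed(2)] unfolding trivial_over_def by blast
  have sub: "A \<subseteq> topspace B" "A' \<subseteq> topspace B"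
    using closed by (auto dest: closedin_subset)
  have \<phi>F: "\<phi> e \<in> topspace F" if "e \<in> topspace E" "\<rho> e \<in> A" for e
    using continuous_map_funspace[OF A(1)] that by (auto simp: Pi_iff)
  have \<phi>'F: "\<phi>' e \<in> topspace F" if "e \<in> topspace E" "\<rho> e \<in> A'" for e
    using continuous_map_funspace[OF A'(1)] that by (auto simp: Pi_iff)
  have \<psi>E: "\<psi> (b, f) \<in> topspace E" if "b \<in> A" "f \<in> topspace F" for b f
    using continuous_map_funspace[OF A(2)] that sub by (auto simp: Pi_iff)
  have \<psi>'E: "\<psi>' (b, f) \<in> topspace E" if "b \<in> A'" "f \<in> topspace F" for b f
    using continuous_map_funspace[OF A'(2)] that sub by (auto simp: Pi_iff)
  define g where "g = (\<lambda>(b, f). \<phi> (\<psi>' (r b, f)))"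
  define g' where "g' = (\<lambda>(b, f). \<phi>' (\<psi> (r b, f)))"
  have rB: "continuous_map (subtopology B A') (subtopology B (A \<inter> A')) r"
    using r by (auto simp: continuous_map_in_subtopology Pi_iff)
  have pair: "continuous_map (prod_topology (subtopology B A') F) (prod_topology (subtopology B (A \<inter> A')) F) (\<lambda>(b, f). (r b, f))"
    using rB by (simp add: continuous_map_prod_top)
  have g: "continuous_map (prod_topology (subtopology B A') F) F g"
  proof -
    have "continuous_map (prod_topology (subtopology B (A \<inter> A')) F) (subtopology E {e \<in> topspace E. \<rho> e \<in> A}) \<psi>'"
      using continuous_map_from_subtopology[OF A'(2), of "(A \<inter> A') \<times> UNIV"] A'(4) \<psi>'E sub
      by (auto simp: continuous_map_in_subtopology prod_topology_subtopology subtopology_subtopology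
          Times_Int_Times Pi_iff Int_left_absorb Int_ac)
    from continuous_map_compose[OF continuous_map_compose[OF pair this] A(1)] show ?thesis
      by (rule continuous_map_eq) (auto simp: g_def)
  qed
  have g': "continuous_map (prod_topology (subtopology B A') F) F g'"
  proof -
    have "continuous_map (prod_topology (subtopology B (A \<inter> A')) F) (subtopology E {e \<in> topspace E. \<rho> e \<in> A'}) \<psi>"
      using continuous_map_from_subtopology[OF A(2), of "(A \<inter> A') \<times> UNIV"] A(4) \<psi>E sub
      by (auto simp: continuous_map_in_subtopology prod_topology_subtopology subtopology_subtopology
          Times_Int_Times Pi_iff Int_left_absorb Int_ac)
    from continuous_map_compose[OF continuous_map_compose[OF pair this] A'(1)] show ?thesis
      by (rule continuous_map_eq) (auto simp: g'_def)
  qed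
  have gF: "g (b, f) \<in> topspace F" "g' (b, f) \<in> topspace F" if "b \<in> A'" "f \<in> topspace F" for b f
    using continuous_map_funspace[OF g] continuous_map_funspace[OF g'] that sub by (auto simp: Pi_iff)
  \<comment> \<open>Both maps change coordinates within the single fibre over \<open>r b\<close>, in
    opposite directions.\<close>
  have gg': "g (b, g' (b, f)) = f" "g' (b, g (b, f)) = f" if "b \<in> A'" "f \<in> topspace F" for b f
  proof -
    have rb: "r b \<in> A" "r b \<in> A'" using r(2)[OF that(1)] by auto
    have "\<psi>' (r b, \<phi>' (\<psi> (r b, f))) = \<psi> (r b, f)"
      using A'(3)[of "\<psi> (r b, f)"] \<psi>E[OF rb(1) that(2)] A(4)[OF rb(1) that(2)] rb by simp
    then show "g (b, g' (b, f)) = f"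
      using A(5)[OF rb(1) that(2)] by (simp add: g_def g'_def)
    have "\<psi> (r b, \<phi> (\<psi>' (r b, f))) = \<psi>' (r b, f)"
      using A(3)[of "\<psi>' (r b, f)"] \<psi>'E[OF rb(2) that(2)] A'(4)[OF rb(2) that(2)] rb by simp
    then show "g' (b, g (b, f)) = f"
      using A'(5)[OF rb(2) that(2)] by (simp add: g_def g'_def)
  qed
  define \<Phi> where "\<Phi> e = (if \<rho> e \<in> A then \<phi> e else g (\<rho> e, \<phi>' e))" for e
  define \<Psi> where "\<Psi> = (\<lambda>(b, f). if b \<in> A then \<psi> (b, f) else \<psi>' (b, g' (b, f)))"
  \<comment> \<open>On the overlap \<open>r\<close> is the identity, so the correction turns
    \<open>\<phi>'\<close> into \<open>\<phi>\<close>; the two clauses of \<open>\<Phi>\<close>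
    agree there. The next fact is the counterpart for \<open>\<Psi>\<close>.\<close>
  have \<Phi>': "\<Phi> e = g (\<rho> e, \<phi>' e)" if "e \<in> topspace E" "\<rho> e \<in> A'" for e
    using that r(3)[of "\<rho> e"] A'(3) by (auto simp: \<Phi>_def g_def)
  have \<Psi>': "\<Psi> (b, f) = \<psi>' (b, g' (b, f))" if "b \<in> A'" "f \<in> topspace F" for b f
  proof (cases "b \<in> A")
    case True
    then have "r b = b" using r(3) that by blast
    then show ?thesis
      using True that A'(3)[of "\<psi> (b, f)"] \<psi>E[OF True that(2)] A(4)[OF True that(2)]
      by (simp add: \<Psi>_def g'_def)
  qed (simp add: \<Psi>_def)
  let ?E = "subtopology E {e \<in> topspace E. \<rho> e \<in> A \<union> A'}"
  let ?BF = "prod_topology (subtopology B (A \<union> A')) F"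
  have subE: "subtopology ?E {e \<in> topspace E. \<rho> e \<in> A} = subtopology E {e \<in> topspace E. \<rho> e \<in> A}"
     "subtopology ?E {e \<in> topspace E. \<rho> e \<in> A'} = subtopology E {e \<in> topspace E. \<rho> e \<in> A'}"
    by (auto simp: subtopology_subtopology intro!: arg_cong[of _ _ "subtopology E"])
  have subBF: "subtopology ?BF (A \<times> UNIV) = prod_topology (subtopology B A) F"
    "subtopology ?BF (A' \<times> UNIV) = prod_topology (subtopology B A') F"
    by (simp_all add: prod_topology_subtopology subtopology_subtopology Times_Int_Times Int_absorb1 Int_absorb2)
  have 1: "continuous_map ?E F \<Phi>"
  proof (rule pasting_lemma_closed[where I = "{True, False}"
      and T = "\<lambda>t. {e \<in> topspace E. \<rho> e \<in> (if t then A else A')}" and f = "\<lambda>_. \<Phi>"])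
    have "closedin E {e \<in> topspace E. \<rho> e \<in> A}" "closedin E {e \<in> topspace E. \<rho> e \<in> A'}"
      using closedin_continuous_map_preimage[OF \<rho>] closed by auto
    then show "closedin ?E {e \<in> topspace E. \<rho> e \<in> (if t then A else A')}" if "t \<in> {True, False}" for t
      by (cases t) (auto intro!: closedin_subset_topspace)
    have "continuous_map (subtopology E {e \<in> topspace E. \<rho> e \<in> A}) F \<Phi>"
      by (rule continuous_map_eq[OF A(1)]) (auto simp: \<Phi>_def)
    moreover have "continuous_map (subtopology E {e \<in> topspace E. \<rho> e \<in> A'}) F \<Phi>"
    proof (rule continuous_map_eq)
      have "continuous_map (subtopology E {e \<in> topspace E. \<rho> e \<in> A'}) (subtopology B A') \<rho>"
        using continuous_map_from_subtopology[OF \<rho>] by (auto simp: continuous_map_in_subtopology Pi_iff)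
      then have "continuous_map (subtopology E {e \<in> topspace E. \<rho> e \<in> A'})
          (prod_topology (subtopology B A') F) (\<lambda>e. (\<rho> e, \<phi>' e))"
        using A'(1) by (simp add: continuous_map_pairedI)
      then show "continuous_map (subtopology E {e \<in> topspace E. \<rho> e \<in> A'}) F (g \<circ> (\<lambda>e. (\<rho> e, \<phi>' e)))"
        using g by (rule continuous_map_compose)
    qed (auto simp: \<Phi>')
    ultimately show "continuous_map (subtopology ?E {e \<in> topspace E. \<rho> e \<in> (if t then A else A')}) F \<Phi>" for t
      using subE by (cases t) simp_all
  qed auto
  have 2: "continuous_map ?BF E \<Psi>"
  proof (rule pasting_lemma_closed[where I = "{True, False}"
      and T = "\<lambda>t. (if t then A else A') \<times> topspace F" and f = "\<lambda>_. \<Psi>"])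
    show "closedin ?BF ((if t then A else A') \<times> topspace F)" if "t \<in> {True, False}" for t
      using closed by (cases t) (auto simp: closedin_prod_Times_iff intro!: closedin_subset_topspace)
    have "continuous_map (prod_topology (subtopology B A) F) E \<Psi>"
      by (rule continuous_map_eq[OF A(2)]) (auto simp: \<Psi>_def)
    moreover have "continuous_map (prod_topology (subtopology B A') F) E \<Psi>"
    proof (rule continuous_map_eq)
      have "continuous_map (prod_topology (subtopology B A') F)
          (prod_topology (subtopology B A') F) (\<lambda>x. (fst x, g' x))"
        using g' by (intro continuous_map_pairedI continuous_map_fst) auto
      then show "continuous_map (prod_topology (subtopology B A') F) E (\<psi>' \<circ> (\<lambda>x. (fst x, g' x)))"
        using A'(2) by (rule continuous_map_compose)
    qed (auto simp: \<Psi>')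
    \<comment> \<open>Closedness of a product piece is stated with \<open>topspace F\<close>,
      restriction of the product topology with \<open>UNIV\<close>.\<close>
    moreover have "subtopology ?BF (S \<times> topspace F) = subtopology ?BF (S \<times> UNIV)" for S
    proof -
      have "topspace ?BF \<inter> S \<times> topspace F = topspace ?BF \<inter> S \<times> UNIV" by auto
      then show ?thesis by (metis subtopology_restrict)
    qed
    ultimately show "continuous_map (subtopology ?BF ((if t then A else A') \<times> topspace F)) E \<Psi>" for t
      using subBF by (cases t) simp_all
  qed auto
  have 3: "\<Psi> (\<rho> e, \<Phi> e) = e" if "e \<in> topspace E" "\<rho> e \<in> A \<union> A'" for e
  proof (cases "\<rho> e \<in> A")
    case True
    then show ?thesis using A(3) that by (simp add: \<Psi>_def \<Phi>_def)
  next
    case False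
    then have "\<rho> e \<in> A'" using that by blast
    then show ?thesis
      using that False gg'(2) \<phi>'F A'(3) by (simp add: \<Psi>_def \<Phi>_def)
  qed
  have 4: "\<rho> (\<Psi> (b, f)) = b \<and> \<Phi> (\<Psi> (b, f)) = f" if "b \<in> A \<union> A'" "f \<in> topspace F" for b f
  proof (cases "b \<in> A")
    case True
    then show ?thesis using A(4,5) that by (simp add: \<Psi>_def \<Phi>_def)
  next
    case False
    then have "b \<in> A'" using that by blast
    then show ?thesis
      using that False gg'(1) gF(2) A'(4,5) by (simp add: \<Psi>_def \<Phi>_def)
  qed
  show ?thesis
    unfolding trivial_over_def using 1 2 3 4 by (intro exI[of _ \<Phi>] exI[of _ \<Psi>]) blast
qed

text \<open>
  Induction on the number \<open>k\<close> of coordinates that range over all of \<open>[-R, R]\<close> while the others stay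
  near a given point; the induction step is a compactness argument in the coordinate \<open>k\<close>.
\<close>

lemma trivial_over_cube:
  assumes \<rho>: "continuous_map E (Euclidean_space q) \<rho>"
    and local: "\<And>y. y \<in> topspace (Euclidean_space q) \<Longrightarrow>
      \<exists>U. openin (Euclidean_space q) U \<and> y \<in> U \<and> trivial_over E (Euclidean_space q) F \<rho> U"
    and R: "R \<ge> 0"
  shows "trivial_over E (Euclidean_space q) F \<rho> {x \<in> topspace (Euclidean_space q). \<forall>i<q. \<bar>x i\<bar> \<le> R}"
proof -
  let ?Y = "Euclidean_space q"
  let ?T = "trivial_over E ?Y F \<rho>"
  have "\<exists>\<epsilon>>0. ?T {x \<in> topspace ?Y. (\<forall>i<k. \<bar>x i\<bar> \<le> R) \<and> (\<forall>i. k \<le> i \<and> i < q \<longrightarrow> \<bar>x i - y i\<bar> \<le> \<epsilon>)}"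
    if "y \<in> topspace ?Y" "k \<le> q" for k y
    using that
  proof (induction k arbitrary: y)
    case 0
    obtain U where U: "openin ?Y U" "y \<in> U" "?T U"
      using local[OF 0(1)] by blast
    obtain \<epsilon> where "\<epsilon> > 0" "\<forall>x\<in>topspace ?Y. (\<forall>i<q. \<bar>x i - y i\<bar> \<le> \<epsilon>) \<longrightarrow> x \<in> U"
      using openin_Euclidean_space_cube[OF U(1,2)] by blast
    then show ?case
      using U(3) by (intro exI[of _ \<epsilon>] conjI) (auto elim!: trivial_over_subset)
  next
    case (Suc k)
    define slab where "slab \<epsilon> c d = {x \<in> topspace ?Y. (\<forall>i<k. \<bar>x i\<bar> \<le> R) \<and> c \<le> x k \<and> x k \<le> d \<and>
      (\<forall>i. k < i \<and> i < q \<longrightarrow> \<bar>x i - y i\<bar> \<le> \<epsilon>)}" for \<epsilon> c d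
    have slab_mono: "slab \<epsilon> c d \<subseteq> slab \<epsilon>' c d" if "\<epsilon> \<le> \<epsilon>'" for \<epsilon> \<epsilon>' c d
      using that by (fastforce simp: slab_def)
    have slab_closed: "closedin ?Y (slab \<epsilon> c d)" for \<epsilon> c d
      unfolding closedin_Euclidean_space_iff slab_def topspace_Euclidean_space mem_Collect_eq
      by (intro conjI closed_Collect_conj closed_Collect_all closed_Collect_imp closed_Collect_le
          closed_Collect_eq open_Collect_const continuous_intros) auto
    have "-R \<le> R" using R by simp
    then have "\<exists>\<epsilon>>0. ?T (slab \<epsilon> (-R) R)"
    \<comment> \<open>A property of intervals that passes to a union of adjacent intervals and holds
      for all short intervals around each point holds for \<open>[-R, R]\<close>. The tolerance
      \<open>\<epsilon>\<close> is quantified inside the property, so it may shrink at each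
      gluing.\<close>
    proof (induction rule: Bolzano)
      case (trans a b c)
      then obtain \<epsilon> \<epsilon>' where e: "\<epsilon> > 0" "?T (slab \<epsilon> a b)" "\<epsilon>' > 0" "?T (slab \<epsilon>' b c)" by blast
      define d where "d = min \<epsilon> \<epsilon>'"
      have d: "?T (slab d a b)" "?T (slab d b c)"
        using trivial_over_subset[OF e(2) slab_mono[of d \<epsilon>]]
          trivial_over_subset[OF e(4) slab_mono[of d \<epsilon>']] by (simp_all add: d_def)
      have "?T (slab d a b \<union> slab d b c)"
      proof (rule trivial_over_glue[OF \<rho> d slab_closed slab_closed])
        \<comment> \<open>Resetting coordinate \<open>k\<close> to \<open>b\<close> retracts the
          second slab onto the face it shares with the first.\<close>
        show "continuous_map (subtopology ?Y (slab d b c)) ?Y (\<lambda>x. x(k := b))"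
          unfolding cm_Euclidean_space_iff_continuous_on
        proof
          show "continuous_on (topspace (subtopology ?Y (slab d b c))) (\<lambda>x. x(k := b))"
          proof (rule continuous_on_coordinatewise_then_product)
            show "continuous_on (topspace (subtopology ?Y (slab d b c))) (\<lambda>x. (x(k := b)) i)" for i
              by (cases "i = k") (auto intro: continuous_on_subset[OF continuous_on_product_coordinates])
          qed
        qed (use Suc.prems(2) in \<open>auto simp: topspace_Euclidean_space\<close>)
        show "x(k := b) \<in> slab d a b \<inter> slab d b c" if "x \<in> slab d b c" for x
          using that trans Suc.prems(2) by (auto simp: slab_def topspace_Euclidean_space)
        show "x(k := b) = x" if "x \<in> slab d a b \<inter> slab d b c" for x
          using that by (auto simp: slab_def)
      qed
      moreover have "slab d a c \<subseteq> slab d a b \<union> slab d b c"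
        by (auto simp: slab_def)
      ultimately have "?T (slab d a c)" by (rule trivial_over_subset)
      then show ?case
        using e by (intro exI[of _ d]) (auto simp: d_def)
    next
      case (local t)
      have "y(k := t) \<in> topspace ?Y"
        using Suc.prems by (auto simp: topspace_Euclidean_space)
      then obtain \<epsilon> where e: "\<epsilon> > 0" "?T {x \<in> topspace ?Y. (\<forall>i<k. \<bar>x i\<bar> \<le> R) \<and>
          (\<forall>i. k \<le> i \<and> i < q \<longrightarrow> \<bar>x i - (y(k := t)) i\<bar> \<le> \<epsilon>)}"
        using Suc.IH[of "y(k := t)"] Suc_leD[OF Suc.prems(2)] by blast
      have "?T (slab \<epsilon> a b)" if "a \<le> t \<and> t \<le> b \<and> b - a < \<epsilon>" for a b
        by (rule trivial_over_subset[OF e(2)]) (use that in \<open>auto simp: slab_def\<close>)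
      then show ?case using e(1) by blast
    qed
    then obtain \<epsilon> where e: "\<epsilon> > 0" "?T (slab \<epsilon> (-R) R)" by blast
    then show ?case
      by (intro exI[of _ \<epsilon>] conjI trivial_over_subset[OF e(2)])
         (auto simp: slab_def less_Suc_eq abs_le_iff minus_le_iff)
  qed
  \<comment> \<open>With \<open>k = q\<close> no coordinate is tied to the centre, so the origin
    will do.\<close>
  from this[of "\<lambda>_. 0" q] obtain \<epsilon> where "?T {x \<in> topspace ?Y. (\<forall>i<q. \<bar>x i\<bar> \<le> R) \<and> (\<forall>i. q \<le> i \<and> i < q \<longrightarrow> \<bar>x i - 0\<bar> \<le> \<epsilon>)}"
    unfolding topspace_Euclidean_space by auto
  then show ?thesis
    by (rule trivial_over_subset) auto
qed

text \<open>Lets the bundle over the punctured sphere be treated as one over \<real>^q: the fibre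
  coordinate is kept and only base points are renamed.\<close>

lemma trivial_over_transfer:
  assumes \<pi>: "continuous_map X B \<pi>" and triv: "trivial_over X B F \<pi> U"
    and hom: "homeomorphic_maps (subtopology B S) Y \<sigma> c"
  shows "trivial_over (subtopology X {x \<in> topspace X. \<pi> x \<in> S}) Y F (\<sigma> \<circ> \<pi>) {y \<in> topspace Y. c y \<in> U}"
proof -
  obtain \<phi> \<psi> where *: "continuous_map (subtopology X {e \<in> topspace X. \<pi> e \<in> U}) F \<phi>"
     "continuous_map (prod_topology (subtopology B U) F) X \<psi>"
     "\<And>e. \<lbrakk>e \<in> topspace X; \<pi> e \<in> U\<rbrakk> \<Longrightarrow> \<psi> (\<pi> e, \<phi> e) = e"
     "\<And>b f. \<lbrakk>b \<in> topspace B; b \<in> U; f \<in> topspace F\<rbrakk> \<Longrightarrow> \<pi> (\<psi> (b, f)) = b"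
     "\<And>b f. \<lbrakk>b \<in> topspace B; b \<in> U; f \<in> topspace F\<rbrakk> \<Longrightarrow> \<phi> (\<psi> (b, f)) = f"
    using triv unfolding trivial_over_def by blast
  have c: "continuous_map Y (subtopology B S) c" "\<And>y. y \<in> topspace Y \<Longrightarrow> \<sigma> (c y) = y"
    "\<And>b. \<lbrakk>b \<in> topspace B; b \<in> S\<rbrakk> \<Longrightarrow> c (\<sigma> b) = b"
    using hom by (auto simp: homeomorphic_maps_def)
  have cB: "c y \<in> topspace B" "c y \<in> S" if "y \<in> topspace Y" for y
    using continuous_map_funspace[OF c(1)] that by (auto simp: Pi_iff)
  have \<pi>B: "\<pi> e \<in> topspace B" if "e \<in> topspace X" for e
    using continuous_map_funspace[OF \<pi>] that by (auto simp: Pi_iff)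
  let ?X = "subtopology X {x \<in> topspace X. \<pi> x \<in> S}"
  let ?U = "{y \<in> topspace Y. c y \<in> U}"
  let ?\<psi> = "\<lambda>(y, f). \<psi> (c y, f)"
  have "continuous_map (subtopology ?X {e \<in> topspace ?X. (\<sigma> \<circ> \<pi>) e \<in> ?U}) F \<phi>"
    unfolding subtopology_subtopology
    using c(3) \<pi>B by (intro continuous_map_from_subtopology_mono[OF *(1)]) auto
  moreover have "continuous_map (prod_topology (subtopology Y ?U) F) ?X ?\<psi>"
  proof -
    have "continuous_map (subtopology Y ?U) (subtopology B U) c"
      using continuous_map_from_subtopology[OF c(1)] by (auto simp: continuous_map_in_subtopology Pi_iff)
    then have "continuous_map (prod_topology (subtopology Y ?U) F) (prod_topology (subtopology B U) F) (\<lambda>(y, f). (c y, f))"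
      by (simp add: continuous_map_prod_top)
    from continuous_map_compose[OF this *(2)]
    have "continuous_map (prod_topology (subtopology Y ?U) F) X ?\<psi>"
      by (rule continuous_map_eq) auto
    moreover from continuous_map_funspace[OF this]
    have "?\<psi> \<in> topspace (prod_topology (subtopology Y ?U) F) \<rightarrow> {x \<in> topspace X. \<pi> x \<in> S}"
      using *(4) cB by (auto simp: Pi_iff)
    ultimately show ?thesis
      by (simp only: continuous_map_in_subtopology)
  qed
  moreover have "\<forall>e\<in>topspace ?X. (\<sigma> \<circ> \<pi>) e \<in> ?U \<longrightarrow> ?\<psi> ((\<sigma> \<circ> \<pi>) e, \<phi> e) = e"
    using c(3) \<pi>B *(3) by auto
  moreover have "\<forall>y\<in>topspace Y \<inter> ?U. \<forall>f\<in>topspace F. (\<sigma> \<circ> \<pi>) (?\<psi> (y, f)) = y \<and> \<phi> (?\<psi> (y, f)) = f"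
    using *(4,5) cB c(2) by auto
  ultimately show ?thesis
    unfolding trivial_over_def by blast
qed

text \<open>By regularity each point has a neighbourhood \<open>V\<close> inside a closed
  \<open>C\<close> over which the bundle is trivial. The part over \<open>C\<close> is the image of
  the compact product of \<open>C\<close> and \<open>F\<close>, and finitely many \<open>V\<close>
  cover the base. Applied to \<open>M\<close>, this makes the triangulation finite.\<close>

lemma compact_space_locally_trivial:
  assumes B: "compact_space B" "Hausdorff_space B" and F: "compact_space F" and \<pi>: "continuous_map X B \<pi>"
    and local: "\<And>b. b \<in> topspace B \<Longrightarrow> \<exists>U. openin B U \<and> b \<in> U \<and> trivial_over X B F \<pi> U"
  shows "compact_space X"
proof -
  have reg: "neighbourhood_base_of (closedin B) B"
    using compact_Hausdorff_imp_regular_space[OF B] by (simp add: neighbourhood_base_of_closedin)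
  have "\<exists>V. openin B V \<and> b \<in> V \<and> (\<exists>K. compactin X K \<and> {x \<in> topspace X. \<pi> x \<in> V} \<subseteq> K)"
    if b: "b \<in> topspace B" for b
  proof -
    obtain U where U: "openin B U" "b \<in> U" "trivial_over X B F \<pi> U"
      using local[OF b] by blast
    obtain V C where V: "openin B V" "closedin B C" "b \<in> V" "V \<subseteq> C" "C \<subseteq> U"
      using reg U(1,2) unfolding neighbourhood_base_of by metis
    have "trivial_over X B F \<pi> C"
      using U(3) V(5) by (rule trivial_over_subset)
    then obtain \<phi> \<psi> where *: "continuous_map (subtopology X {e \<in> topspace X. \<pi> e \<in> C}) F \<phi>"
      "continuous_map (prod_topology (subtopology B C) F) X \<psi>"
      "\<And>e. \<lbrakk>e \<in> topspace X; \<pi> e \<in> C\<rbrakk> \<Longrightarrow> \<psi> (\<pi> e, \<phi> e) = e"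
      unfolding trivial_over_def by blast
    let ?P = "prod_topology (subtopology B C) F"
    have "compact_space ?P"
      using F B(1) V(2) by (simp add: compact_space_prod_topology compact_space_subtopology closedin_compact_space)
    then have "compactin X (\<psi> ` topspace ?P)"
      using *(2) by (simp add: compact_space_def image_compactin)
    moreover have "{x \<in> topspace X. \<pi> x \<in> V} \<subseteq> \<psi> ` topspace ?P"
    proof
      fix x assume x: "x \<in> {x \<in> topspace X. \<pi> x \<in> V}"
      then have "\<pi> x \<in> C" "\<pi> x \<in> topspace B" "\<phi> x \<in> topspace F"
        using V(4) continuous_map_funspace[OF \<pi>] continuous_map_funspace[OF *(1)] by (auto simp: Pi_iff)
      then have "(\<pi> x, \<phi> x) \<in> topspace ?P" "x = \<psi> (\<pi> x, \<phi> x)"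
        using *(3) x by auto
      then show "x \<in> \<psi> ` topspace ?P" by (rule rev_image_eqI)
    qed
    ultimately show ?thesis using V(1,3) by blast
  qed
  then obtain V K where VK: "\<And>b. b \<in> topspace B \<Longrightarrow> openin B (V b) \<and> b \<in> V b"
      "\<And>b. b \<in> topspace B \<Longrightarrow> compactin X (K b)"
      "\<And>b. b \<in> topspace B \<Longrightarrow> {x \<in> topspace X. \<pi> x \<in> V b} \<subseteq> K b"
    by metis
  have "compactin B (topspace B)" "\<And>W. W \<in> V ` topspace B \<Longrightarrow> openin B W"
    "topspace B \<subseteq> \<Union>(V ` topspace B)"
    using B(1) VK(1) by (auto simp: compact_space_def)
  then obtain \<F> where F': "finite \<F>" "\<F> \<subseteq> V ` topspace B" "topspace B \<subseteq> \<Union>\<F>"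
    using compactinD[of B "topspace B" "V ` topspace B"] by auto
  then obtain I where I: "finite I" "I \<subseteq> topspace B" "topspace B \<subseteq> \<Union>(V ` I)"
    using finite_subset_image[OF F'(1,2)] by blast
  have "topspace X \<subseteq> \<Union>(K ` I)"
  proof
    fix x assume x: "x \<in> topspace X"
    then have "\<pi> x \<in> topspace B" using continuous_map_funspace[OF \<pi>] by (auto simp: Pi_iff)
    then obtain b where "b \<in> I" "\<pi> x \<in> V b" using I(3) by blast
    then show "x \<in> \<Union>(K ` I)" using VK(3)[of b] I(2) x by blast
  qed
  moreover have "compactin X (\<Union>(K ` I))"
    using I VK(2) by (intro compactin_Union) auto
  ultimately show ?thesis
    unfolding compact_space_def by (metis compactin_subset_topspace subset_antisym)
qed

lemma smooth_fibre_bundle_locally_trivial: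
  assumes E: "smooth_fibre_bundle E B F \<pi>" and b: "b \<in> topspace (mtop B)"
  shows "\<exists>U. openin (mtop B) U \<and> b \<in> U \<and> trivial_over (mtop E) (mtop B) (mtop F) \<pi> U"
proof -
  obtain U \<Phi> where U: "openin (mtop B) U" "b \<in> U"
    "diffeomorphism (open_submanifold E {x \<in> topspace (mtop E). \<pi> x \<in> U})
          (prod_manifold (open_submanifold B U) F) \<Phi>"
    "\<And>x. \<lbrakk>x \<in> topspace (mtop E); \<pi> x \<in> U\<rbrakk> \<Longrightarrow> fst (\<Phi> x) = \<pi> x"
    using E b unfolding smooth_fibre_bundle_def by blast
  let ?W = "{x \<in> topspace (mtop E). \<pi> x \<in> U}"
  let ?P = "prod_topology (subtopology (mtop B) U) (mtop F)"
  define \<Psi> where "\<Psi> = inv_into ?W \<Phi>"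
  have \<Phi>: "continuous_map (subtopology (mtop E) ?W) ?P \<Phi>" "bij_betw \<Phi> ?W (topspace ?P)"
    "continuous_map ?P (subtopology (mtop E) ?W) \<Psi>"
    using U(3) unfolding diffeomorphism_def smooth_map_def
    by (auto simp: open_submanifold_def prod_manifold_def \<Psi>_def Int_absorb1 subset_iff cong: conj_cong)
  have inv: "\<And>x. x \<in> ?W \<Longrightarrow> \<Psi> (\<Phi> x) = x" "\<And>z. z \<in> topspace ?P \<Longrightarrow> \<Phi> (\<Psi> z) = z"
    "\<And>z. z \<in> topspace ?P \<Longrightarrow> \<Psi> z \<in> ?W"
    using \<Phi>(2) unfolding \<Psi>_def
    by (auto simp: bij_betw_inv_into_left bij_betw_inv_into_right)
       (metis (mono_tags, lifting) bij_betw_def inv_into_into mem_Collect_eq topspace_prod_topology topspace_subtopology mem_Sigma_iff IntI)+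
  have "continuous_map (subtopology (mtop E) ?W) (mtop F) (snd \<circ> \<Phi>)"
    using \<Phi>(1) continuous_map_snd by (rule continuous_map_compose)
  moreover have "continuous_map ?P (mtop E) \<Psi>"
    using \<Phi>(3) by (simp add: continuous_map_in_subtopology)
  moreover have "\<Psi> (\<pi> x, (snd \<circ> \<Phi>) x) = x" if "x \<in> topspace (mtop E)" "\<pi> x \<in> U" for x
    using U(4)[OF that] inv(1)[of x] that by (metis (mono_tags, lifting) comp_apply mem_Collect_eq prod.collapse)
  moreover have "\<pi> (\<Psi> (b, f)) = b \<and> (snd \<circ> \<Phi>) (\<Psi> (b, f)) = f"
    if "b \<in> topspace (mtop B) \<inter> U" "f \<in> topspace (mtop F)" for b f
  proof -
    have "(b, f) \<in> topspace ?P" using that by simp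
    with inv(2,3)[OF this] U(4)[of "\<Psi> (b, f)"] show ?thesis by auto
  qed
  ultimately show ?thesis
    unfolding trivial_over_def using U(1,2) by (intro exI[of _ U] conjI exI[of _ "snd \<circ> \<Phi>"] exI[of _ \<Psi>]) auto
qed

section \<open>Geometric realizations\<close>

text \<open>A closed subset of a product of unit intervals, compact by Tychonoff even if the vertex
  type is infinite.\<close>

lemma compact_closed_simplex:
  assumes s: "finite s"
  shows "compact (closed_simplex s)"
proof -
  have "closed (closed_simplex s)"
    unfolding closed_simplex_def
    by (intro closed_Collect_conj closed_Collect_all closed_Collect_imp closed_Collect_le
        closed_Collect_eq open_Collect_const continuous_intros continuous_on_product_coordinates)
  moreover have "compactin (powertop_real UNIV) (PiE UNIV (\<lambda>_. {0..1::real}))"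
    by (simp add: compactin_PiE)
  then have "compact (PiE UNIV (\<lambda>_. {0..1::real}) :: ('a \<Rightarrow> real) set)"
    by (simp add: euclidean_product_topology)
  moreover have "closed_simplex s \<subseteq> PiE UNIV (\<lambda>_. {0..1})"
  proof
    fix x assume x: "x \<in> closed_simplex s"
    have "x v \<le> 1" for v
    proof (cases "v \<in> s")
      case True
      then have "x v \<le> sum x s"
        using x s by (intro member_le_sum) (auto simp: closed_simplex_def)
      then show ?thesis using x by (simp add: closed_simplex_def)
    qed (use x in \<open>simp add: closed_simplex_def\<close>)
    then show "x \<in> PiE UNIV (\<lambda>_. {0..1})"
      using x by (auto simp: closed_simplex_def)
  qed
  ultimately show ?thesis
    by (metis compact_Int_closed inf.absorb_iff2)
qed

lemma closed_simplex_subset_simplex_param_image: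
  assumes e: "bij_betw e {..k} s"
  shows "closed_simplex s \<subseteq> simplex_param k s e ` standard_simplex k"
proof
  fix x assume x: "x \<in> closed_simplex s"
  have s: "finite s" using e bij_betw_finite by blast
  define y where "y = (\<lambda>i. if i \<le> k then x (e i) else 0)"
  have "x v = simplex_param k s e y v" for v
  proof (cases "v \<in> s")
    case True
    then have "inv_into {..k} e v \<in> {..k}" "e (inv_into {..k} e v) = v"
      using e by (metis bij_betw_imp_surj_on inv_into_into, metis e bij_betw_inv_into_right)
    then show ?thesis using True by (simp add: simplex_param_def y_def)
  qed (use x in \<open>simp add: simplex_param_def closed_simplex_def\<close>)
  moreover have "y \<in> standard_simplex k"
  proof -
    have sum: "(\<Sum>i\<le>k. y i) = 1"
      using x sum.reindex_bij_betw[OF e, of x] by (simp add: y_def closed_simplex_def)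
    have nonneg: "0 \<le> y i" for i
      using x by (simp add: y_def closed_simplex_def)
    have "y i \<le> 1" for i
    proof (cases "i \<le> k")
      case True
      then show ?thesis
        using member_le_sum[of i "{..k}" y] nonneg by (simp only: sum) simp
    qed (simp add: y_def)
    then show ?thesis
      using nonneg sum by (auto simp: standard_simplex_def y_def)
  qed
  ultimately show "x \<in> simplex_param k s e ` standard_simplex k" by blast
qed

lemma compact_space_realization:
  assumes "finite K" "\<And>s. s \<in> K \<Longrightarrow> finite s"
  shows "compact_space (realization K)"
proof -
  have "compactin (realization K) (closed_simplex s)" if s: "s \<in> K" for s
  proof -
    have "continuous_map (top_of_set (closed_simplex s)) (realization K) id"
      unfolding continuous_map_def
    proof (intro conjI allI impI)
      show "id \<in> topspace (top_of_set (closed_simplex s)) \<rightarrow> topspace (realization K)"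
        using s by (auto simp: topspace_realization)
      fix W assume "openin (realization K) W"
      then have "openin (top_of_set (closed_simplex s)) (W \<inter> closed_simplex s)"
        using s by (simp add: openin_realization realization_open_def euclidean_product_topology)
      moreover have "{x \<in> topspace (top_of_set (closed_simplex s)). id x \<in> W} = W \<inter> closed_simplex s"
        by auto
      ultimately show "openin (top_of_set (closed_simplex s)) {x \<in> topspace (top_of_set (closed_simplex s)). id x \<in> W}"
        by simp
    qed
    moreover have "compactin (top_of_set (closed_simplex s)) (closed_simplex s)"
      using compact_closed_simplex assms(2)[OF s] by (simp add: compactin_subtopology)
    ultimately have "compactin (realization K) (id ` closed_simplex s)"
      by (rule image_compactin[rotated])
    then show ?thesis by simp
  qed
  then have "compactin (realization K) (\<Union>(closed_simplex ` K))"
    using assms(1) by (intro compactin_Union) auto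
  then show ?thesis
    by (simp add: compact_space_def topspace_realization)
qed

text \<open>The barycentres of the simplices form a closed discrete subset of the realization.\<close>

lemma compact_realization_imp_finite:
  assumes K: "abstract_complex K" and compact: "compact_space (realization K)"
  shows "finite K"
proof -
  define \<beta> :: "'a set \<Rightarrow> 'a \<Rightarrow> real" where "\<beta> s = (\<lambda>v. if v \<in> s then 1 / real (card s) else 0)" for s
  have simplex: "finite s" "s \<noteq> {}" "card s > 0" if "s \<in> K" for s
    using K that by (auto simp: abstract_complex_def card_gt_0_iff)
  have pos: "\<beta> s v > 0 \<longleftrightarrow> v \<in> s" if "s \<in> K" for s v
    using simplex(3)[OF that] by (simp add: \<beta>_def)
  have inj: "s = t" if "s \<in> K" "t \<in> K" "\<beta> s = \<beta> t" for s t
    using pos[OF that(1)] pos[OF that(2)] that(3) by auto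
  have mem: "\<beta> s \<in> closed_simplex s" if "s \<in> K" for s
    using simplex[OF that] by (simp add: closed_simplex_def \<beta>_def)
  have face: "t \<subseteq> s" if "t \<in> K" "\<beta> t \<in> closed_simplex s" for s t
    using pos[OF that(1)] that(2) by (auto simp: closed_simplex_def) (metis less_irrefl)
  \<comment> \<open>All barycentres but that of \<open>s\<close> are removed. This leaves an open
    set, because a closed simplex contains barycentres of its own faces only, which are finitely
    many. As \<open>\<beta> s\<close> lies in \<open>W s\<close> alone, a finite subcover must use
    every simplex.\<close>
  define W where "W s = topspace (realization K) - \<beta> ` (K - {s})" for s
  have W: "openin (realization K) (W s)" for s
    unfolding openin_realization realization_open_def
  proof (intro conjI ballI)
    show "W s \<subseteq> (\<Union>s\<in>K. closed_simplex s)"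
      by (auto simp: W_def topspace_realization)
    fix t assume t: "t \<in> K"
    let ?F = "\<beta> ` (K - {s}) \<inter> closed_simplex t"
    have "?F \<subseteq> \<beta> ` Pow t"
      using face by blast
    then have "finite ?F"
      using simplex(1)[OF t] by (meson finite_Pow_iff finite_imageI finite_subset)
    moreover have "Hausdorff_space (powertop_real (UNIV :: 'a set))"
      by (simp add: Hausdorff_space_product_topology)
    ultimately have "closedin (powertop_real UNIV) ?F"
      by (intro closedin_Hausdorff_finite) auto
    then have "closed ?F" by (simp add: euclidean_product_topology)
    then have "openin (top_of_set (closed_simplex t)) (closed_simplex t \<inter> (- ?F))"
      by (intro openin_open_Int open_Compl)
    moreover have "closed_simplex t \<inter> (- ?F) = W s \<inter> closed_simplex t"
      using t by (auto simp: W_def topspace_realization)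
    ultimately show "openin (subtopology (powertop_real UNIV) (closed_simplex t)) (W s \<inter> closed_simplex t)"
      by (simp add: euclidean_product_topology)
  qed
  show ?thesis
  proof (cases "K = {}")
    case False
    have "topspace (realization K) \<subseteq> \<Union>(W ` K)"
    proof
      fix x assume x: "x \<in> topspace (realization K)"
      show "x \<in> \<Union>(W ` K)"
      proof (cases "x \<in> \<beta> ` K")
        case True
        then obtain s where "s \<in> K" "x = \<beta> s" by blast
        then have "x \<in> W s" using x inj by (auto simp: W_def)
        then show ?thesis using \<open>s \<in> K\<close> by blast
      qed (use x False in \<open>auto simp: W_def\<close>)
    qed
    then obtain \<F> where F: "finite \<F>" "\<F> \<subseteq> W ` K" "topspace (realization K) \<subseteq> \<Union>\<F>"
      using compactinD[of "realization K" "topspace (realization K)" "W ` K"] compact W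
      by (auto simp: compact_space_def)
    then obtain I where I: "finite I" "I \<subseteq> K" "\<F> = W ` I"
      using finite_subset_image[OF F(1,2)] by blast
    have "K \<subseteq> I"
    proof
      fix s assume s: "s \<in> K"
      then have "\<beta> s \<in> topspace (realization K)"
        using mem by (auto simp: topspace_realization)
      then obtain t where "t \<in> I" "\<beta> s \<in> W t" using F(3) I(3) by blast
      then show "s \<in> I" using s by (auto simp: W_def)
    qed
    then show ?thesis using I(1) finite_subset by blast
  qed simp
qed

text \<open>Continuity is enough for restricting the triangulation to the skeleton: compactness
  supplies the embedding later, so the weak topology is not compared with the subspace
  topology.\<close>

lemma realization_subcomplex:
  assumes "L \<subseteq> K"
  shows "continuous_map (realization L) (realization K) id"
  unfolding continuous_map_def
proof (intro conjI allI impI)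
  show "id \<in> topspace (realization L) \<rightarrow> topspace (realization K)"
    using assms by (auto simp: topspace_realization)
  fix W assume W: "openin (realization K) W"
  have "(topspace (realization L) \<inter> W) \<inter> closed_simplex s = W \<inter> closed_simplex s" if "s \<in> L" for s
    using that by (auto simp: topspace_realization)
  then have "openin (realization L) (topspace (realization L) \<inter> W)"
    using W assms unfolding openin_realization realization_open_def
    by (auto simp: topspace_realization)
  moreover have "{x \<in> topspace (realization L). id x \<in> W} = topspace (realization L) \<inter> W"
    by auto
  ultimately show "openin (realization L) {x \<in> topspace (realization L). id x \<in> W}" by simp
qed

section \<open>The embedding\<close>

text \<open>Polar coordinates: the factor \<open>exp (y 0)\<close> is a positive radius, which the
  norm of the first p+1 entries recovers.\<close>

lemma sphere_times_Euclidean_space_embeds: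
  assumes q: "q > 0"
  obtains J where "continuous_map (prod_topology (Euclidean_space q) (nsphere p)) (Euclidean_space (p + q)) J"
    "inj_on J (topspace (prod_topology (Euclidean_space q) (nsphere p)))"
proof -
  let ?P = "prod_topology (Euclidean_space q) (nsphere p)"
  define J :: "(nat \<Rightarrow> real) \<times> (nat \<Rightarrow> real) \<Rightarrow> nat \<Rightarrow> real"
    \<comment> \<open>Index \<open>p + 1\<close> carries \<open>y 1\<close>, as \<open>y 0\<close>
      is already used up in the radius. From \<open>p + q\<close> on the entries are
      \<open>y j\<close> with \<open>j \<ge> q\<close>, hence 0.\<close>
    where "J = (\<lambda>(y, u) i. if i \<le> p then exp (y 0) * u i else y (i - p))"
  have y: "continuous_map ?P euclideanreal (\<lambda>z. fst z i)" for i
  proof -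
    have "continuous_map (Euclidean_space q) euclideanreal (\<lambda>x. x i)"
      unfolding Euclidean_space_def
      by (intro continuous_map_from_subtopology continuous_map_product_projection UNIV_I)
    from continuous_map_compose[OF continuous_map_fst this] show ?thesis
      by (simp add: comp_def)
  qed
  have u: "continuous_map ?P euclideanreal (\<lambda>z. snd z i)" for i
    using continuous_map_compose[OF continuous_map_snd continuous_map_nsphere_projection]
    by (simp add: comp_def)
  have "continuous_map euclideanreal euclideanreal (exp :: real \<Rightarrow> real)"
    by (auto intro: continuous_intros)
  from continuous_map_compose[OF y[of 0] this]
  have "continuous_map ?P euclideanreal (\<lambda>z. exp (fst z 0))"
    by (simp add: comp_def)
  then have "continuous_map ?P euclideanreal (\<lambda>z. J z i)" for i
    using y u by (cases "i \<le> p") (auto simp: J_def case_prod_beta intro: continuous_map_real_mult)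
  moreover have "J z \<in> {x. \<forall>i\<ge>p + q. x i = 0}" if "z \<in> topspace ?P" for z
    using that q by (auto simp: J_def topspace_Euclidean_space)
  ultimately have "continuous_map ?P (Euclidean_space (p + q)) J"
    unfolding Euclidean_space_def[of "p + q"]
    by (auto simp: continuous_map_in_subtopology continuous_map_componentwise_UNIV)
  moreover have "inj_on J (topspace ?P)"
  proof (rule inj_onI)
    fix z z' assume z: "z \<in> topspace ?P" "z' \<in> topspace ?P" and eq: "J z = J z'"
    obtain y u y' u' where zz: "z = (y, u)" "z' = (y', u')" by fastforce
    have norm: "(\<Sum>i\<le>p. (J (y, u) i)\<^sup>2) = (exp (y 0))\<^sup>2" if "u \<in> topspace (nsphere p)" for y u
      using that by (simp add: J_def topspace_nsphere power_mult_distrib flip: sum_distrib_left)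
    have "(exp (y 0))\<^sup>2 = (exp (y' 0))\<^sup>2"
      using norm[of u y] norm[of u' y'] z eq by (simp add: zz)
    then have 0: "y 0 = y' 0" by (simp add: power2_eq_iff_nonneg)
    have "y i = y' i" for i
      using 0 fun_cong[OF eq, of "i + p"] by (cases "i = 0") (simp_all add: zz J_def)
    moreover have "u i = u' i" for i
      using 0 fun_cong[OF eq, of i] z by (cases "i \<le> p") (simp_all add: zz J_def topspace_nsphere)
    ultimately show "z = z'" by (auto simp: zz)
  qed
  ultimately show thesis by (rule that)
qed

lemma compact_space_nsphere: "compact_space (nsphere n)"
proof -
  have "closed (topspace (nsphere n))"
    unfolding topspace_nsphere
    by (intro closed_Collect_conj closed_Collect_all closed_Collect_imp
        closed_Collect_eq open_Collect_const continuous_intros continuous_on_product_coordinates)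
  moreover have "compactin (powertop_real UNIV) (PiE UNIV (\<lambda>_. {-1..1::real}) :: (nat \<Rightarrow> real) set)"
    by (simp add: compactin_PiE)
  then have "compact (PiE UNIV (\<lambda>_. {-1..1::real}) :: (nat \<Rightarrow> real) set)"
    by (simp add: euclidean_product_topology)
  moreover have "topspace (nsphere n) \<subseteq> PiE UNIV (\<lambda>_. {-1..1})"
  proof
    fix x assume x: "x \<in> topspace (nsphere n)"
    have "(x i)\<^sup>2 \<le> 1" for i
      using x member_le_sum[of i "{..n}" "\<lambda>i. (x i)\<^sup>2"] by (cases "i \<le> n") (auto simp: topspace_nsphere)
    then have "\<bar>x i\<bar> \<le> 1" for i
      by (simp add: abs_square_le_1)
    then show "x \<in> PiE UNIV (\<lambda>_. {-1..1})" by (auto simp: abs_le_iff minus_le_iff)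
  qed
  ultimately have "compact (topspace (nsphere n))"
    by (metis compact_Int_closed inf.absorb_iff2)
  then show ?thesis
    by (subst nsphere_top_of_set) (simp add: compact_space_subtopology)
qed

lemma Hausdorff_space_nsphere: "Hausdorff_space (nsphere n)"
  unfolding nsphere_def by (intro Hausdorff_space_subtopology Hausdorff_Euclidean_space)

text \<open>The topological half of the proof, for an arbitrary compact space in place of the
  skeleton. Off the fibre over \<open>b\<close>, a point is determined by its base coordinate
  \<open>\<rho>\<close> and its fibre coordinate \<open>\<phi>\<close> over a large cube, and
  \<open>\<psi>\<close> recovers it from the pair.\<close>

lemma embeddable_avoiding_fibre:
  assumes M: "smooth_fibre_bundle M (sphere_manifold q) (sphere_manifold p) \<pi>"
    and q: "q > 0" and b: "b \<in> topspace (nsphere q)"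
    and X: "compact_space X" and h: "continuous_map X (mtop M) h" "inj_on h (topspace X)"
    and miss: "\<And>x. x \<in> topspace X \<Longrightarrow> \<pi> (h x) \<noteq> b"
  shows "embeddable X (Euclidean_space (p + q))"
proof -
  let ?Y = "Euclidean_space q"
  let ?E = "subtopology (mtop M) {e \<in> topspace (mtop M). \<pi> e \<in> - {b}}"
  have mtop: "mtop (sphere_manifold n) = nsphere n" for n
    by (simp add: sphere_manifold_def)
  have \<pi>: "continuous_map (mtop M) (nsphere q) \<pi>"
    using M by (simp add: smooth_fibre_bundle_def smooth_map_def mtop)
  obtain \<sigma> c where \<sigma>c: "homeomorphic_maps (subtopology (nsphere q) (- {b})) ?Y \<sigma> c"
    using nsphere_minus_point_homeomorphic_Euclidean_space[OF b] unfolding homeomorphic_space_def by blast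
  define \<rho> where "\<rho> = \<sigma> \<circ> \<pi>"
  have "continuous_map ?E (subtopology (nsphere q) (- {b})) \<pi>"
    using continuous_map_from_subtopology[OF \<pi>] by (auto simp: continuous_map_in_subtopology)
  then have \<rho>: "continuous_map ?E ?Y \<rho>"
    using \<sigma>c unfolding \<rho>_def homeomorphic_maps_def by (blast intro: continuous_map_compose)
  have hE: "continuous_map X ?E h"
    using h(1) miss continuous_map_funspace[OF h(1)] by (auto simp: continuous_map_in_subtopology Pi_iff)
  have local: "\<exists>U. openin ?Y U \<and> y \<in> U \<and> trivial_over ?E ?Y (nsphere p) \<rho> U" if y: "y \<in> topspace ?Y" for y
  proof -
    have c: "continuous_map ?Y (nsphere q) c"
      using \<sigma>c by (auto simp: homeomorphic_maps_def continuous_map_in_subtopology)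
    have "c y \<in> topspace (nsphere q)"
      using continuous_map_funspace[OF c] y by blast
    then obtain U where U: "openin (nsphere q) U" "c y \<in> U" "trivial_over (mtop M) (nsphere q) (nsphere p) \<pi> U"
      using smooth_fibre_bundle_locally_trivial[OF M] by (auto simp: mtop)
    have "trivial_over ?E ?Y (nsphere p) \<rho> {y \<in> topspace ?Y. c y \<in> U}"
      unfolding \<rho>_def by (rule trivial_over_transfer[OF \<pi> U(3) \<sigma>c])
    then show ?thesis
      using openin_continuous_map_preimage[OF c U(1)] U(2) y by blast
  qed
  have \<rho>h: "continuous_map X ?Y (\<lambda>x. \<rho> (h x))"
    using continuous_map_compose[OF hE \<rho>] by (simp add: comp_def)
  have "\<exists>B. \<forall>x\<in>topspace X. \<bar>\<rho> (h x) i\<bar> \<le> B" for i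
  proof -
    have "continuous_map X euclideanreal (\<lambda>x. \<rho> (h x) i)"
      using \<rho>h by (simp add: Euclidean_space_def continuous_map_in_subtopology continuous_map_componentwise_UNIV)
    then have "compact ((\<lambda>x. \<rho> (h x) i) ` topspace X)"
      using X by (metis compactin_euclidean_iff compact_space_def image_compactin)
    then have "bounded ((\<lambda>x. \<rho> (h x) i) ` topspace X)" by (rule compact_imp_bounded)
    then show ?thesis by (auto simp: bounded_iff)
  qed
  then obtain B where B: "\<And>i x. x \<in> topspace X \<Longrightarrow> \<bar>\<rho> (h x) i\<bar> \<le> B i" by metis
  \<comment> \<open>A common bound for all coordinates; the sum of absolute values is also
    nonnegative, as \<open>trivial_over_cube\<close> demands.\<close>
  define R where "R = (\<Sum>i<q. \<bar>B i\<bar>)"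
  have "\<bar>\<rho> (h x) i\<bar> \<le> R" if "x \<in> topspace X" "i < q" for x i
  proof -
    have "\<bar>\<rho> (h x) i\<bar> \<le> \<bar>B i\<bar>" using B[OF that(1), of i] by linarith
    also have "\<dots> \<le> R" unfolding R_def using that(2) by (intro member_le_sum) auto
    finally show ?thesis .
  qed
  then have cube: "\<rho> (h x) \<in> {y \<in> topspace ?Y. \<forall>i<q. \<bar>y i\<bar> \<le> R}" if "x \<in> topspace X" for x
    using continuous_map_funspace[OF \<rho>h] that by blast
  have "R \<ge> 0" by (simp add: R_def sum_nonneg)
  then have "trivial_over ?E ?Y (nsphere p) \<rho> {y \<in> topspace ?Y. \<forall>i<q. \<bar>y i\<bar> \<le> R}"
    using trivial_over_cube[OF \<rho> local] by blast
  then obtain \<phi> \<psi> where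
    \<phi>: "continuous_map (subtopology ?E {e \<in> topspace ?E. \<rho> e \<in> {y \<in> topspace ?Y. \<forall>i<q. \<bar>y i\<bar> \<le> R}}) (nsphere p) \<phi>"
    and \<psi>: "\<And>e. \<lbrakk>e \<in> topspace ?E; \<rho> e \<in> {y \<in> topspace ?Y. \<forall>i<q. \<bar>y i\<bar> \<le> R}\<rbrakk> \<Longrightarrow> \<psi> (\<rho> e, \<phi> e) = e"
    unfolding trivial_over_def by blast
  have hE': "h x \<in> topspace ?E" if "x \<in> topspace X" for x
    using continuous_map_funspace[OF hE] that by blast
  have "continuous_map X (subtopology ?E {e \<in> topspace ?E. \<rho> e \<in> {y \<in> topspace ?Y. \<forall>i<q. \<bar>y i\<bar> \<le> R}}) h"
    unfolding continuous_map_in_subtopology[of X ?E] using hE hE' cube by blast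
  from continuous_map_compose[OF this \<phi>]
  have \<phi>h: "continuous_map X (nsphere p) (\<lambda>x. \<phi> (h x))" by (simp add: comp_def)
  obtain J where J: "continuous_map (prod_topology ?Y (nsphere p)) (Euclidean_space (p + q)) J"
    "inj_on J (topspace (prod_topology ?Y (nsphere p)))"
    using sphere_times_Euclidean_space_embeds[OF q] by blast
  define f where "f x = J (\<rho> (h x), \<phi> (h x))" for x
  have pair: "continuous_map X (prod_topology ?Y (nsphere p)) (\<lambda>x. (\<rho> (h x), \<phi> (h x)))"
    using \<rho>h \<phi>h by (rule continuous_map_pairedI)
  have f: "continuous_map X (Euclidean_space (p + q)) f"
    using continuous_map_compose[OF pair J(1)] by (simp add: f_def[abs_def] comp_def)
  have P: "(\<rho> (h x), \<phi> (h x)) \<in> topspace (prod_topology ?Y (nsphere p))" if "x \<in> topspace X" for x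
    using funcset_mem[OF continuous_map_funspace[OF pair] that] .
  have "inj_on f (topspace X)"
  proof (rule inj_onI)
    fix x x' assume x: "x \<in> topspace X" "x' \<in> topspace X" and eq: "f x = f x'"
    have \<psi>h: "\<psi> (\<rho> (h x), \<phi> (h x)) = h x" if "x \<in> topspace X" for x
      by (rule \<psi>[OF hE' cube]; fact that)
    have "(\<rho> (h x), \<phi> (h x)) = (\<rho> (h x'), \<phi> (h x'))"
      by (rule inj_onD[OF J(2) eq[unfolded f_def] P[OF x(1)] P[OF x(2)]])
    then have "\<psi> (\<rho> (h x), \<phi> (h x)) = \<psi> (\<rho> (h x'), \<phi> (h x'))"
      by (rule arg_cong)
    then have "h x = h x'"
      unfolding \<psi>h[OF x(1)] \<psi>h[OF x(2)] .
    then show "x = x'" using h(2) x by (meson inj_onD)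
  qed
  moreover have "closed_map X (Euclidean_space (p + q)) f"
    using f X Hausdorff_Euclidean_space by (rule T1_Spaces.continuous_imp_closed_map)
  ultimately have "embedding_map X (Euclidean_space (p + q)) f"
    using f by (intro injective_closed_imp_embedding_map)
  then show ?thesis
    unfolding embeddable_def by blast
qed

theorem corollary1p3:
  fixes p q :: nat
    and M :: "'m manifold" and \<pi> :: "'m \<Rightarrow> nat \<Rightarrow> real"
    and K :: "'v set set" and h :: "('v \<Rightarrow> real) \<Rightarrow> 'm"
  assumes "smooth_fibre_bundle M (sphere_manifold q) (sphere_manifold p) \<pi>"
    and "smooth_triangulation K h M"
  shows "embeddable (realization (skeleton (int q - 1) K)) (Euclidean_space (p + q))"
proof -
  define L where "L = skeleton (int q - 1) K"
  have K: "abstract_complex K" and hom: "homeomorphic_map (realization K) (mtop M) h"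
    and smooth: "\<And>s k e. \<lbrakk>s \<in> K; bij_betw e {..k} s\<rbrakk> \<Longrightarrow> smooth_simplex_embedding k M (h \<circ> simplex_param k s e)"
    using assms(2) by (auto simp: smooth_triangulation_def)
  have L: "s \<in> K" "finite s" "card s > 0" "card s \<le> q" if "s \<in> L" for s
    using that K by (auto simp: L_def skeleton_def abstract_complex_def card_gt_0_iff)
  show ?thesis
  \<comment> \<open>The index \<open>int q - 1\<close> is an integer, so for \<open>q = 0\<close> it
    is -1 and excludes every nonempty simplex. The empty space embeds by any map.\<close>
  proof (cases "q = 0")
    case True
    then have "L = {}" using L by force
    then have empty: "realization L = trivial_topology"
      by (simp add: topspace_realization flip: null_topspace_iff_trivial)
    have "embedding_map (realization L) (Euclidean_space (p + q)) (\<lambda>_ _. 0)"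
      unfolding empty by (intro injective_closed_imp_embedding_map) (auto simp: closed_map_def)
    then show ?thesis unfolding embeddable_def L_def by blast
  next
    case False
    have mtop: "mtop (sphere_manifold n) = nsphere n" for n
      by (simp add: sphere_manifold_def)
    have M: "smooth_manifold M" and \<pi>: "smooth_map M (sphere_manifold q) \<pi>"
      using assms(1) by (auto simp: smooth_fibre_bundle_def)
    have "compact_space (mtop M)"
      using smooth_fibre_bundle_locally_trivial[OF assms(1)] \<pi>
      by (intro compact_space_locally_trivial[of "nsphere q" "nsphere p" _ \<pi>])
        (auto simp: mtop smooth_map_def compact_space_nsphere Hausdorff_space_nsphere)
    then have "compact_space (realization K)"
      using hom homeomorphic_compact_space homeomorphic_map_imp_homeomorphic_space by blast
    then have "finite K" by (rule compact_realization_imp_finite[OF K])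
    then have finL: "finite L" by (simp add: L_def skeleton_def)
    then have compact: "compact_space (realization L)"
      using L(2) by (rule compact_space_realization)
    \<comment> \<open>A simplex is nonempty, so \<open>card s - 1\<close> is its true dimension
      without truncation; with \<open>card s \<le> q\<close> it is less than
      \<open>q\<close>.\<close>
    have "\<exists>e. bij_betw e {..card s - 1} s" if "s \<in> L" for s
      using L(2,3)[OF that] ex_bij_betw_nat_finite[of s]
      by (metis Suc_pred' atLeast0LessThan lessThan_Suc_atMost)
    then obtain e where e: "\<And>s. s \<in> L \<Longrightarrow> bij_betw (e s) {..card s - 1} s" by metis
    define \<sigma> where "\<sigma> s = h \<circ> simplex_param (card s - 1) s (e s)" for s
    have "card s - 1 < q" if "s \<in> L" for s
      using L(3,4)[OF that] by linarith
    moreover have "smooth_simplex_embedding (card s - 1) M (\<sigma> s)" if "s \<in> L" for s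
      unfolding \<sigma>_def using L(1)[OF that] e[OF that] by (rule smooth)
    ultimately obtain b where b: "b \<in> topspace (nsphere q)"
      "b \<notin> (\<Union>s\<in>L. \<pi> ` \<sigma> s ` standard_simplex (card s - 1))"
      using smooth_simplices_miss_sphere_point[OF M \<pi> _ finL, of "\<lambda>s. card s - 1" \<sigma>] False by auto
    have "\<pi> (h x) \<noteq> b" if x: "x \<in> topspace (realization L)" for x
    proof -
      obtain s where s: "s \<in> L" "x \<in> closed_simplex s"
        using x by (auto simp: topspace_realization)
      then obtain y where "y \<in> standard_simplex (card s - 1)" "x = simplex_param (card s - 1) s (e s) y"
        using closed_simplex_subset_simplex_param_image[OF e] by blast
      then have "\<pi> (h x) \<in> \<pi> ` \<sigma> s ` standard_simplex (card s - 1)" by (simp add: \<sigma>_def)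
      then show ?thesis using b(2) s(1) by blast
    qed
    moreover have "L \<subseteq> K" using L(1) by blast
    then have sub: "continuous_map (realization L) (realization K) id" by (rule realization_subcomplex)
    have "continuous_map (realization L) (mtop M) h"
      using continuous_map_compose[OF sub homeomorphic_imp_continuous_map[OF hom]] by simp
    moreover have "topspace (realization L) \<subseteq> topspace (realization K)"
      using continuous_map_funspace[OF sub] by auto
    then have "inj_on h (topspace (realization L))"
      by (rule inj_on_subset[OF homeomorphic_imp_injective_map[OF hom]])
    ultimately show ?thesis
      using False b(1) compact unfolding L_def[symmetric]
      by (intro embeddable_avoiding_fibre[OF assms(1), of b _ h]) auto
  qed
qed

end
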